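(* Let $G$ and $H$ be amenable groups such that $G\times H$ satisfies the Ornstein-Weiss lemma. Then $G$ and $H$ satisfy the Ornstein-Weiss lemma.
   Context: Topological groups are assumed $T_1$ (hence Hausdorff). A locally compact group $G$ is unimodular if it admits a Haar measure, meaning a non-zero regular Borel measure $\mu$ with $\mu(gA)=\mu(A)=\mu(Ag)$ for all $g\in G$ and all Borel sets $A\subseteq G$; it is unique up to scaling and $\mu$ denotes a fixed one. For $A,B\subseteq G$ write $AB=\{ab: a\in A, b\in B\}$ and $A^c=G\setminus A$. For $K,A\subseteq G$ the $K$-boundary of $A$ is $\partial_K A:=K\overline{A}\cap K\overline{A^c}$. A directed set is a non-empty partially ordered set in which every finite subset has an upper bound; a net is a family indexed by a directed set. A net $(A_i)_{i\in I}$ of compact subsets of a unimodular group $G$ is a Van Hove net if there is $j\in I$ such that $A_i$ has non-empty interior for all $i\ge j$, and $\lim_{i\in I}\mu(\partial_K A_i)/\mu(A_i)=0$ for every compact $K\subseteq G$. An amenable group is a unimodular (locally compact) group that contains a Van Hove net. $\mathcal{K}(G)$ is the set of all compact subsets of $G$. A function $f\colon\mathcal{K}(G)\to\mathbb{R}$ is subadditive if $f(A\cup B)\le f(A)+f(B)$ for all disjoint $A,B\in\mathcal{K}(G)$; right invariant if $f(Ag)=f(A)$ for all $A\in\mathcal{K}(G)$, $g\in G$; monotone if $f(A)\le f(B)$ whenever $A,B\in\mathcal{K}(G)$ and $A\subseteq B$. An amenable group $G$ satisfies the Ornstein-Weiss lemma if for every subadditive, right invariant and monotone $f\colon\mathcal{K}(G)\to\mathbb{R}$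 the limit $\lim_{i\in I} f(A_i)/\mu(A_i)$ exists, is finite, and does not depend on the choice of the Van Hove net $(A_i)_{i\in I}$ in $G$. *)

theory Defs
  imports "HOL-Analysis.Analysis"
begin

section \<open>Topological groups\<close>

text \<open>Groups are written additively, following \<^class>\<open>topological_group_add\<close>;
  commutativity is \<^emph>\<open>not\<close> assumed. The product of two groups is the product type with
  componentwise operations and the product topology. For sets \<open>A\<close> and \<open>B\<close>,
  \<open>A + B\<close> is the elementwise sum.\<close>

class topological_group = topological_group_add + t1_space

instance topological_group \<subseteq> t2_space
proof
  fix x y :: 'a
  assume "x \<noteq> y"
  define W where "W = (\<lambda>p :: 'a \<times> 'a. fst p - snd p) -` (- {0})"
  have "open W"
    unfolding W_def
    by (intro open_vimage continuous_intros)
  moreover have "(x, y) \<in> W"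
    using \<open>x \<noteq> y\<close> by (simp add: W_def)
  ultimately obtain U V where UV: "open U" "open V" "(x, y) \<in> U \<times> V" "U \<times> V \<subseteq> W"
    by (rule open_prod_elim)
  have "U \<inter> V = {}"
    using UV(4) by (force simp: W_def)
  then show "\<exists>U V. open U \<and> open V \<and> x \<in> U \<and> y \<in> V \<and> U \<inter> V = {}"
    using UV by blast
qed

instance prod :: (topological_group_add, topological_group_add) topological_group_add
proof
  fix a b :: "'a \<times> 'b"
  have id: "((\<lambda>x. x) \<longlongrightarrow> c) (nhds c)" for c :: "'c::topological_space"
    by (rule filterlim_ident)
  have "((\<lambda>p. (fst (fst p) + fst (snd p), snd (fst p) + snd (snd p)))
      \<longlongrightarrow> (fst (fst (a, b)) + fst (snd (a, b)), snd (fst (a, b)) + snd (snd (a, b)))) (nhds (a, b))"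
    by (intro tendsto_Pair tendsto_add tendsto_fst tendsto_snd id)
  then show "LIM x (nhds a \<times>\<^sub>F nhds b). fst x + snd x :> nhds (a + b)"
    by (simp add: nhds_prod plus_prod_def)
  have "((\<lambda>p. (- fst p, - snd p)) \<longlongrightarrow> (- fst a, - snd a)) (nhds a)"
    by (intro tendsto_Pair tendsto_minus tendsto_fst tendsto_snd id)
  moreover have "(\<lambda>p :: 'a \<times> 'b. (- fst p, - snd p)) = uminus"
    by (simp add: fun_eq_iff uminus_prod_def)
  ultimately show "(uminus \<longlongrightarrow> - a) (nhds a)"
    by (simp add: uminus_prod_def)
qed

instance prod :: (topological_group, topological_group) topological_group ..

section \<open>Haar measures\<close>

text \<open>Regularity is the usual one for Haar measures: finite on compact sets, outer regular on
  Borel sets, and inner regular on open sets. Inner regularity on all Borel sets fails for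
  some non-sigma-compact groups.\<close>

definition regular_borel_measure :: "'a::topological_group measure \<Rightarrow> bool" where
  "regular_borel_measure \<mu> \<longleftrightarrow>
     sets \<mu> = sets borel \<and>
     (\<forall>K. compact K \<longrightarrow> emeasure \<mu> K < \<infinity>) \<and>
     (\<forall>B\<in>sets borel. emeasure \<mu> B = (INF U\<in>{U. open U \<and> B \<subseteq> U}. emeasure \<mu> U)) \<and>
     (\<forall>U. open U \<longrightarrow> emeasure \<mu> U = (SUP K\<in>{K. compact K \<and> K \<subseteq> U}. emeasure \<mu> K))"

definition haar_measure :: "'a::topological_group measure \<Rightarrow> bool" where
  "haar_measure \<mu> \<longleftrightarrow>
     regular_borel_measure \<mu> \<and> emeasure \<mu> UNIV \<noteq> 0 \<and>
     (\<forall>g. \<forall>A\<in>sets borel.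
        emeasure \<mu> ((\<lambda>a. g + a) ` A) = emeasure \<mu> A \<and>
        emeasure \<mu> ((\<lambda>a. a + g) ` A) = emeasure \<mu> A)"

section \<open>Nets\<close>

definition directed_set :: "'i set \<Rightarrow> 'i rel \<Rightarrow> bool" where
  "directed_set I r \<longleftrightarrow> I \<noteq> {} \<and> partial_order_on I r \<and>
     (\<forall>F. finite F \<and> F \<subseteq> I \<longrightarrow> (\<exists>u\<in>I. \<forall>x\<in>F. (x, u) \<in> r))"

text \<open>Convergence of a net \<open>x\<close> indexed by \<open>(I, r)\<close> is \<open>(x \<longlongrightarrow> l) (net_filter I r)\<close>; see
  \<open>eventually_net_filter\<close> below.\<close>

definition net_filter :: "'i set \<Rightarrow> 'i rel \<Rightarrow> 'i filter" where
  "net_filter I r = (INF j\<in>I. principal {i\<in>I. (j, i) \<in> r})"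

lemma eventually_net_filter:
  assumes "directed_set I r"
  shows "eventually P (net_filter I r) \<longleftrightarrow> (\<exists>j\<in>I. \<forall>i\<in>I. (j, i) \<in> r \<longrightarrow> P i)"
proof -
  have tr: "trans r"
    using assms by (auto simp: directed_set_def dest: partial_order_onD)
  have ub: "\<exists>x\<in>I. (a, x) \<in> r \<and> (b, x) \<in> r" if "a \<in> I" "b \<in> I" for a b
    using assms that unfolding directed_set_def
    by (auto dest!: conjunct2 spec[of _ "{a, b}"])
  have "eventually P (net_filter I r) \<longleftrightarrow>
      (\<exists>j\<in>I. eventually P (principal {i\<in>I. (j, i) \<in> r}))"
    unfolding net_filter_def
  proof (rule eventually_INF_base)
    show "I \<noteq> {}"
      using assms by (simp add: directed_set_def)
    fix a b assume "a \<in> I" "b \<in> I"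
    with ub obtain x where "x \<in> I" "(a, x) \<in> r" "(b, x) \<in> r" by blast
    then show "\<exists>x\<in>I. principal {i \<in> I. (x, i) \<in> r}
        \<le> inf (principal {i \<in> I. (a, i) \<in> r}) (principal {i \<in> I. (b, i) \<in> r})"
      using tr by (auto intro!: bexI[of _ x] dest: transD)
  qed
  then show ?thesis
    by (auto simp: eventually_principal)
qed

section \<open>Van Hove nets, amenability and the Ornstein--Weiss lemma\<close>

definition boundary :: "'a::topological_group set \<Rightarrow> 'a set \<Rightarrow> 'a set" where
  "boundary K A = (K + closure A) \<inter> (K + closure (- A))"

text \<open>All sets measured below are of finite measure, since \<open>boundary K A \<subseteq> K + A\<close> for closed \<open>A\<close>;
  this justifies the real-valued \<^const>\<open>measure\<close>. Quotients with denominator 0 can only occur before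
  the index from which on the sets have non-empty interior.\<close>

definition van_hove_net ::
  "'a::topological_group measure \<Rightarrow> 'i set \<Rightarrow> 'i rel \<Rightarrow> ('i \<Rightarrow> 'a set) \<Rightarrow> bool" where
  "van_hove_net \<mu> I r A \<longleftrightarrow>
     directed_set I r \<and> (\<forall>i\<in>I. compact (A i)) \<and>
     (\<exists>j\<in>I. \<forall>i\<in>I. (j, i) \<in> r \<longrightarrow> interior (A i) \<noteq> {}) \<and>
     (\<forall>K. compact K \<longrightarrow>
        ((\<lambda>i. measure \<mu> (boundary K (A i)) / measure \<mu> (A i)) \<longlongrightarrow> 0) (net_filter I r))"

text \<open>HOL cannot quantify over index types inside a definition, so nets of subsets of \<open>'a\<close> are
  indexed by directed sets within one sufficiently large type. No net is lost:
  \<open>van_hove_net_reindex\<close>, \<open>amenable_group_any_index\<close> and \<open>ornstein_weiss_any_index\<close> below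
  cover directed sets of arbitrary type.\<close>

type_synonym 'a net_index = "'a set set \<times> 'a set \<times> nat"

text \<open>The parameter \<open>\<mu>\<close> is the fixed Haar measure of the group.\<close>

definition unimodular_group :: "'a::topological_group measure \<Rightarrow> bool" where
  "unimodular_group \<mu> \<longleftrightarrow>
     locally_compact_space (euclidean :: 'a topology) \<and> haar_measure \<mu>"

definition amenable_group :: "'a::topological_group measure \<Rightarrow> bool" where
  "amenable_group \<mu> \<longleftrightarrow>
     unimodular_group \<mu> \<and> (\<exists>(I :: 'a net_index set) r A. van_hove_net \<mu> I r A)"

text \<open>Functions on the compact subsets of a group are total functions on sets, of which only the
  values at compact sets matter.\<close>

definition subadditive_on_compacts :: "('a::topological_group set \<Rightarrow> real) \<Rightarrow> bool" where
  "subadditive_on_compacts f \<longleftrightarrow>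
     (\<forall>A B. compact A \<and> compact B \<and> A \<inter> B = {} \<longrightarrow> f (A \<union> B) \<le> f A + f B)"

definition right_invariant_on_compacts :: "('a::topological_group set \<Rightarrow> real) \<Rightarrow> bool" where
  "right_invariant_on_compacts f \<longleftrightarrow> (\<forall>A g. compact A \<longrightarrow> f ((\<lambda>a. a + g) ` A) = f A)"

definition monotone_on_compacts :: "('a::topological_group set \<Rightarrow> real) \<Rightarrow> bool" where
  "monotone_on_compacts f \<longleftrightarrow> (\<forall>A B. compact A \<and> compact B \<and> A \<subseteq> B \<longrightarrow> f A \<le> f B)"

definition ornstein_weiss :: "'a::topological_group measure \<Rightarrow> bool" where
  "ornstein_weiss \<mu> \<longleftrightarrow>
     (\<forall>f. subadditive_on_compacts f \<and> right_invariant_on_compacts f \<and>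
          monotone_on_compacts f \<longrightarrow>
        (\<exists>L::real. \<forall>(I :: 'a net_index set) r A. van_hove_net \<mu> I r A \<longrightarrow>
           ((\<lambda>i. f (A i) / measure \<mu> (A i)) \<longlongrightarrow> L) (net_filter I r)))"

subsection \<open>Independence of the index type\<close>

lemma net_reindex:
  fixes A :: "'i \<Rightarrow> 'a set"
  assumes "directed_set I r"
  obtains J :: "'a net_index set" and s B where
    "directed_set J s" "B ` J \<subseteq> A ` I"
    "filtermap B (net_filter J s) = filtermap A (net_filter I r)"
proof -
  have r: "refl_on I r" "trans r" "I \<noteq> {}"
    using assms by (auto simp: directed_set_def dest: partial_order_onD)
  define T where "T i = A ` {k\<in>I. (i, k) \<in> r}" for i
  define J :: "'a net_index set" where "J = {(S, x, n). S \<in> T ` I \<and> x \<in> S}"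
  define s :: "'a net_index rel" where
    "s = {(p, q). p \<in> J \<and> q \<in> J \<and>
        (p = q \<or> fst q \<subseteq> fst p \<and> snd (snd p) < snd (snd q))}"
  define B :: "'a net_index \<Rightarrow> 'a set" where "B = (\<lambda>p. fst (snd p))"
  have self: "A i \<in> T i" if "i \<in> I" for i
    using r(1) that by (auto simp: T_def refl_on_def)
  have mono: "T k \<subseteq> T i" if "(i, k) \<in> r" for i k
    using r(2) that by (auto simp: T_def dest: transD)
  have inJ: "(T i, A i, n) \<in> J" if "i \<in> I" for i n
    using that self by (auto simp: J_def)
  have po: "partial_order_on J s"
    unfolding partial_order_on_def preorder_on_def
  proof (intro conjI)
    show "s \<subseteq> J \<times> J" "refl_on J s"
      by (auto simp: s_def refl_on_def)
    show "trans s"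
      unfolding trans_def s_def by (clarsimp; force)
    show "antisym s"
      unfolding antisym_def s_def by auto
  qed
  have dir: "\<exists>u\<in>J. \<forall>x\<in>F. (x, u) \<in> s" if F: "finite F" "F \<subseteq> J" for F
  proof -
    have "\<forall>p\<in>F. \<exists>i. i \<in> I \<and> fst p = T i"
      using F(2) by (force simp: J_def)
    then obtain c where c: "\<And>p. p \<in> F \<Longrightarrow> c p \<in> I \<and> fst p = T (c p)"
      by metis
    have "finite (c ` F)" "c ` F \<subseteq> I"
      using F c by auto
    then obtain k where k: "k \<in> I" "\<And>p. p \<in> F \<Longrightarrow> (c p, k) \<in> r"
      using assms unfolding directed_set_def by (metis imageI)
    obtain n where n: "\<And>p. p \<in> F \<Longrightarrow> snd (snd p) < n"
      using finite_nat_set_iff_bounded[of "(snd \<circ> snd) ` F"] F(1) by auto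
    have "(p, (T k, A k, n)) \<in> s" if "p \<in> F" for p
      using that F(2) inJ[OF k(1)] n c mono[OF k(2)] by (auto simp: s_def)
    then show ?thesis
      using inJ[OF k(1)] by blast
  qed
  have "J \<noteq> {}"
    using r(3) inJ by blast
  with po dir have J: "directed_set J s"
    by (auto simp: directed_set_def)
  have "eventually (\<lambda>p. P (B p)) (net_filter J s) \<longleftrightarrow>
        eventually (\<lambda>i. P (A i)) (net_filter I r)" for P
    unfolding eventually_net_filter[OF J] eventually_net_filter[OF assms]
  proof
    assume "\<exists>j\<in>J. \<forall>i\<in>J. (j, i) \<in> s \<longrightarrow> P (B i)"
    then obtain p where p: "p \<in> J" "\<And>q. q \<in> J \<Longrightarrow> (p, q) \<in> s \<Longrightarrow> P (B q)" by blast
    from p(1) obtain i x n where i: "i \<in> I" "p = (T i, x, n)"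
      by (auto simp: J_def)
    have "P (A k)" if "k \<in> I" "(i, k) \<in> r" for k
    proof -
      have "(p, (T k, A k, Suc n)) \<in> s"
        using p(1) i that inJ[OF that(1)] mono[OF that(2)] by (auto simp: s_def)
      from p(2)[OF inJ[OF that(1)] this] show ?thesis by (simp add: B_def)
    qed
    with i show "\<exists>j\<in>I. \<forall>i\<in>I. (j, i) \<in> r \<longrightarrow> P (A i)" by blast
  next
    assume "\<exists>j\<in>I. \<forall>i\<in>I. (j, i) \<in> r \<longrightarrow> P (A i)"
    then obtain i where i: "i \<in> I" "\<And>k. k \<in> I \<Longrightarrow> (i, k) \<in> r \<Longrightarrow> P (A k)" by blast
    have "P (B q)" if "((T i, A i, 0), q) \<in> s" for q
    proof -
      have "q \<in> J" "fst q \<subseteq> T i"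
        using that by (auto simp: s_def)
      then have "B q \<in> T i"
        by (auto simp: J_def B_def)
      then show ?thesis
        using i by (auto simp: T_def)
    qed
    then show "\<exists>j\<in>J. \<forall>i\<in>J. (j, i) \<in> s \<longrightarrow> P (B i)"
      using inJ[OF i(1)] by blast
  qed
  then have "filtermap B (net_filter J s) = filtermap A (net_filter I r)"
    by (simp add: filter_eq_iff eventually_filtermap)
  moreover have "B ` J \<subseteq> A ` I"
    by (auto simp: B_def J_def T_def)
  ultimately show ?thesis
    using J that by blast
qed

lemma van_hove_net_reindex:
  fixes A :: "'i \<Rightarrow> 'a::topological_group set"
  assumes "van_hove_net \<mu> I r A"
  obtains J :: "'a net_index set" and s B where
    "van_hove_net \<mu> J s B"
    "filtermap B (net_filter J s) = filtermap A (net_filter I r)"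
proof -
  have dI: "directed_set I r"
    using assms by (simp add: van_hove_net_def)
  obtain J :: "'a net_index set" and s B where J:
    "directed_set J s" "B ` J \<subseteq> A ` I"
    "filtermap B (net_filter J s) = filtermap A (net_filter I r)"
    using net_reindex[OF dI] by blast
  have ev: "eventually (\<lambda>j. P (B j)) (net_filter J s) \<longleftrightarrow>
        eventually (\<lambda>i. P (A i)) (net_filter I r)" for P
    using arg_cong[OF J(3), of "eventually P"] by (simp add: eventually_filtermap)
  have lim: "((\<lambda>j. g (B j)) \<longlongrightarrow> l) (net_filter J s) \<longleftrightarrow>
        ((\<lambda>i. g (A i)) \<longlongrightarrow> l) (net_filter I r)" for g and l :: real
    using arg_cong[OF J(3), of "filterlim g (nhds l)"] by (simp add: filterlim_filtermap)
  have "eventually (\<lambda>j. interior (B j) \<noteq> {}) (net_filter J s)"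
    using assms unfolding ev[of "\<lambda>S. interior S \<noteq> {}"] eventually_net_filter[OF dI]
    by (simp add: van_hove_net_def)
  then have "\<exists>j\<in>J. \<forall>i\<in>J. (j, i) \<in> s \<longrightarrow> interior (B i) \<noteq> {}"
    by (simp add: eventually_net_filter[OF J(1)])
  moreover have "\<forall>j\<in>J. compact (B j)"
  proof
    fix j assume "j \<in> J"
    then obtain i where "i \<in> I" "B j = A i"
      using J(2) by blast
    with assms show "compact (B j)"
      by (simp add: van_hove_net_def)
  qed
  moreover have "\<forall>K. compact K \<longrightarrow>
      ((\<lambda>j. measure \<mu> (boundary K (B j)) / measure \<mu> (B j)) \<longlongrightarrow> 0) (net_filter J s)"
    using assms lim[of "\<lambda>S. measure \<mu> (boundary K S) / measure \<mu> S" for K]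
    by (simp add: van_hove_net_def)
  ultimately have "van_hove_net \<mu> J s B"
    using J(1) by (simp add: van_hove_net_def)
  with J(3) that show ?thesis by blast
qed

lemma amenable_group_any_index:
  fixes \<mu> :: "'a::topological_group measure"
  assumes "unimodular_group \<mu>" "van_hove_net \<mu> I r A"
  shows "amenable_group \<mu>"
proof -
  obtain J :: "'a net_index set" and s B where "van_hove_net \<mu> J s B"
    using van_hove_net_reindex[OF assms(2)] by blast
  then show ?thesis
    using assms(1) unfolding amenable_group_def by blast
qed

lemma ornstein_weiss_any_index:
  fixes \<mu> :: "'a::topological_group measure" and L :: real
  assumes "\<And>(J :: 'a net_index set) s B. van_hove_net \<mu> J s B \<Longrightarrow>
      ((\<lambda>j. f (B j) / measure \<mu> (B j)) \<longlongrightarrow> L) (net_filter J s)"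
    and "van_hove_net \<mu> I r A"
  shows "((\<lambda>i. f (A i) / measure \<mu> (A i)) \<longlongrightarrow> L) (net_filter I r)"
proof -
  obtain J :: "'a net_index set" and s B where J: "van_hove_net \<mu> J s B"
    "filtermap B (net_filter J s) = filtermap A (net_filter I r)"
    using van_hove_net_reindex[OF assms(2)] by blast
  have "((\<lambda>S. f S / measure \<mu> S) \<longlongrightarrow> L) (filtermap B (net_filter J s))"
    using assms(1)[OF J(1)] by (simp add: filterlim_filtermap)
  then show ?thesis
    by (simp add: J(2) filterlim_filtermap)
qed

end

theory Submission
  imports Defs
begin

text \<open>The idea is to turn a set function \<open>f\<close> on the compact subsets of \<open>G\<close> into a set function \<open>F\<close> on the
compact subsets of \<open>G \<times> H\<close> by integrating the values of \<open>f\<close> on the slices of a set: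
\<open>F(C)\<close> is the integral over \<open>h \<in> H\<close> of \<open>f {g. (g, h) \<in> C}\<close>. The slice of a union is the union of the
slices, and translating \<open>C\<close> translates the slices and permutes them by a translation of \<open>H\<close>, so
\<open>F\<close> inherits subadditivity, right invariance and monotonicity. On a rectangle,
\<open>F(A \<times> B) = f(A) \<nu>(B)\<close>. If \<open>A\<^sub>i\<close> is any Van Hove net in \<open>G\<close> and \<open>B\<^sub>j\<close> a fixed one in \<open>H\<close>, which
exists by amenability, then \<open>A\<^sub>i \<times> B\<^sub>j\<close> is a Van Hove net in \<open>G \<times> H\<close>, and the limit that the
Ornstein--Weiss lemma of \<open>G \<times> H\<close> provides for \<open>F\<close> is, up to a constant, the limit of
\<open>f(A\<^sub>i) / \<mu>(A\<^sub>i)\<close>. The factor \<open>H\<close> is treated in the same way after exchanging coordinates.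

Three points need care.

First, nothing makes \<open>h \<mapsto> f {g. (g, h) \<in> C}\<close> measurable. The upper integral is used instead: it is
subadditive, monotone and translation invariant on arbitrary functions, and this is all
that the properties of \<open>F\<close> require (\<open>upper_integral_add_le\<close>, \<open>upper_integral_translate\<close>). On
rectangles the integrand is a multiple of an indicator function, so there the upper integral is the
integral (\<open>slice_integral_rectangle\<close>).

Second, \<open>\<rho>\<close> is an arbitrary Haar measure of \<open>G \<times> H\<close>, so one has to know that
\<open>\<rho>(A \<times> B) = c \<mu>(A) \<nu>(B)\<close> for compact \<open>A\<close> and \<open>B\<close> (\<open>haar_measure_rectangle\<close>). For fixed \<open>B\<close> the map
\<open>A \<mapsto> \<rho>(A \<times> B)\<close> is a right invariant measure on \<open>G\<close>, so this is the uniqueness of Haar measure. Groups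
need be neither second countable nor \<open>\<sigma>\<close>-compact, hence Fubini's theorem for Borel sets of a
product is not at hand. A finite version of the usual double counting takes its place and gives
\<open>\<kappa>(-W) \<mu>(A) \<le> \<mu>(W) \<kappa>(-W + A)\<close> for any two regular right invariant measures and compact \<open>A\<close>, \<open>W\<close>
(\<open>double_counting\<close>). Letting \<open>W\<close> run through small symmetric neighbourhoods of \<open>0\<close> gives
\<open>\<kappa>(A) \<mu>(B) = \<kappa>(B) \<mu>(A)\<close> (\<open>invariant_measure_unique\<close>).

Third, the product of Van Hove nets is a Van Hove net (\<open>van_hove_net_product\<close>): the boundary of
\<open>A \<times> B\<close> lies in \<open>\<partial>A \<times> (L + B) \<union> (K + A) \<times> \<partial>B\<close>, and \<open>K + A\<close> exceeds \<open>A\<close> by no more than a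
boundary of \<open>A\<close>, so relative to \<open>\<rho>(A \<times> B)\<close> both parts are small.\<close>

section \<open>Compact sets in topological groups\<close>

text \<open>The tube lemma for two compact factors. Uniform neighbourhoods, closedness of sums and outer
regularity of sections all come from it, with \<open>W\<close> the preimage of an open set under a group
operation.\<close>

lemma compact_tube:
  fixes K :: "'a::topological_space set" and L :: "'b::topological_space set"
  assumes "compact K" "compact L" "open W" "K \<times> L \<subseteq> W"
  obtains U V where "open U" "open V" "K \<subseteq> U" "L \<subseteq> V" "U \<times> V \<subseteq> W"
proof -
  have "openin (prod_topology euclidean euclidean) W"
    using assms(3) by (auto simp: openin_prod_topology_alt elim!: open_prod_elim)
  then show ?thesis
    using Wallace_theorem_prod_topology[of euclidean K euclidean L W] assms that by auto
qed

lemma compact_set_plus: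
  fixes K L :: "'a::topological_group set"
  assumes "compact K" "compact L"
  shows "compact (K + L)"
proof -
  have "K + L = (\<lambda>p. fst p + snd p) ` (K \<times> L)"
    by (force simp: set_plus_def)
  moreover have "compact ((\<lambda>p. fst p + snd p) ` (K \<times> L))"
    by (intro compact_continuous_image compact_Times assms continuous_intros)
  ultimately show ?thesis
    by simp
qed

lemma compact_uminus:
  fixes K :: "'a::topological_group set"
  assumes "compact K"
  shows "compact (uminus ` K)"
  by (intro compact_continuous_image assms continuous_intros)

lemma translate_eq_vimage:
  fixes A :: "'a::group_add set"
  shows "(\<lambda>a. a + g) ` A = (\<lambda>a. a - g) -` A"
  by (force simp: image_iff intro: bexI[of _ "_ - g"])

lemma open_translate:
  fixes A :: "'a::topological_group set"
  assumes "open A"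
  shows "open ((\<lambda>a. a + g) ` A)"
  unfolding translate_eq_vimage by (intro open_vimage assms continuous_intros)

lemma borel_translate:
  fixes A :: "'a::topological_group set"
  assumes "A \<in> sets borel"
  shows "(\<lambda>a. a + g) ` A \<in> sets borel"
proof -
  have "(\<lambda>a::'a. a - g) \<in> borel_measurable borel"
    by (intro borel_measurable_continuous_onI continuous_intros)
  from measurable_sets[OF this assms] show ?thesis
    by (simp add: translate_eq_vimage)
qed

text \<open>If \<open>x \<notin> K + C\<close>, then \<open>- k + x \<notin> C\<close> for all \<open>k \<in> K\<close>, and by compactness of \<open>K\<close> this persists for
all points of a neighbourhood of \<open>x\<close>. This makes boundaries of compact sets compact, hence
measurable.\<close>

lemma closed_compact_plus_closed:
  fixes K C :: "'a::topological_group set"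
  assumes "compact K" "closed C"
  shows "closed (K + C)"
  unfolding closed_def
proof (subst open_subopen, intro ballI)
  fix x assume x: "x \<in> - (K + C)"
  let ?W = "(\<lambda>p. - fst p + snd p) -` (- C)"
  have "open ?W"
    using assms(2) by (intro open_vimage continuous_intros) auto
  moreover have "K \<times> {x} \<subseteq> ?W"
  proof clarsimp
    fix k assume k: "k \<in> K" "- k + x \<in> C"
    have "k + (- k + x) \<in> K + C"
      using k by (intro set_plus_intro)
    then show False
      using x by (simp add: add.assoc[symmetric])
  qed
  ultimately obtain U V where UV: "open U" "open V" "K \<subseteq> U" "{x} \<subseteq> V" "U \<times> V \<subseteq> ?W"
    by (rule compact_tube[OF assms(1) compact_sing])
  have "V \<subseteq> - (K + C)"
  proof
    fix y assume y: "y \<in> V"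
    show "y \<in> - (K + C)"
    proof
      assume "y \<in> K + C"
      then obtain k c where kc: "y = k + c" "k \<in> K" "c \<in> C"
        by (auto elim: set_plus_elim)
      have "- k + y \<notin> C"
        using UV kc(2) y by (auto simp: subset_iff)
      then show False
        using kc by (simp add: add.assoc[symmetric])
    qed
  qed
  then show "\<exists>T. open T \<and> x \<in> T \<and> T \<subseteq> - (K + C)"
    using UV by blast
qed

lemma compact_plus_nbhd:
  fixes K :: "'a::topological_group set"
  assumes "compact K" "open V" "K \<subseteq> V"
  obtains U where "open U" "0 \<in> U" "K + U \<subseteq> V"
proof -
  have "open ((\<lambda>p. fst p + snd p) -` V)"
    by (intro open_vimage assms continuous_intros)
  moreover have "K \<times> {0} \<subseteq> (\<lambda>p. fst p + snd p) -` V"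
    using assms(3) by auto
  ultimately obtain X U where "open X" "open U" "K \<subseteq> X" "{0} \<subseteq> U" "X \<times> U \<subseteq> (\<lambda>p. fst p + snd p) -` V"
    by (rule compact_tube[OF assms(1) compact_sing])
  then show ?thesis
    by (intro that[of U]) (auto simp: subset_iff elim!: set_plus_elim)
qed

lemma nbhd_plus_compact:
  fixes K :: "'a::topological_group set"
  assumes "compact K" "open V" "K \<subseteq> V"
  obtains U where "open U" "0 \<in> U" "U + K \<subseteq> V"
proof -
  have "open ((\<lambda>p. fst p + snd p) -` V)"
    by (intro open_vimage assms continuous_intros)
  moreover have "{0} \<times> K \<subseteq> (\<lambda>p. fst p + snd p) -` V"
    using assms(3) by auto
  ultimately obtain U X where "open U" "open X" "{0} \<subseteq> U" "K \<subseteq> X" "U \<times> X \<subseteq> (\<lambda>p. fst p + snd p) -` V"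
    by (rule compact_tube[OF compact_sing assms(1)])
  then show ?thesis
    by (intro that[of U]) (auto simp: subset_iff elim!: set_plus_elim)
qed

lemma compact_nbhd_within:
  fixes x :: "'a::topological_group"
  assumes "locally_compact_space (euclidean :: 'a topology)" "open U" "x \<in> U"
  obtains V W where "open V" "compact W" "x \<in> V" "V \<subseteq> W" "W \<subseteq> U"
proof -
  have compactin_eq: "compactin (euclidean :: 'a topology) = compact"
    by (simp add: fun_eq_iff)
  have "Hausdorff_space (euclidean :: 'a topology)"
    using separation_t2 unfolding Hausdorff_space_def disjnt_def by auto
  then have "neighbourhood_base_of compact (euclidean :: 'a topology)"
    using assms(1) locally_compact_space_neighbourhood_base[of "euclidean :: 'a topology"]
    by (simp add: compactin_eq)
  then show ?thesis
    using assms that unfolding neighbourhood_base_of by (metis open_openin)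
qed

lemma symmetric_compact_nbhd:
  fixes U :: "'a::topological_group set"
  assumes "locally_compact_space (euclidean :: 'a topology)" "open U" "0 \<in> U"
  obtains V W where "open V" "compact W" "0 \<in> V" "V \<subseteq> W" "W \<subseteq> U" "uminus ` W = W"
proof -
  have "open (U \<inter> uminus -` U)"
    by (intro open_Int open_vimage assms continuous_intros)
  moreover have "0 \<in> U \<inter> uminus -` U"
    using assms(3) by simp
  ultimately obtain V W where VW: "open V" "compact W" "0 \<in> V" "V \<subseteq> W" "W \<subseteq> U \<inter> uminus -` U"
    using compact_nbhd_within[OF assms(1)] by metis
  show ?thesis
  proof (rule that[of V "W \<union> uminus ` W"])
    show "compact (W \<union> uminus ` W)"
      using VW by (intro compact_Un compact_uminus)
    show "uminus ` (W \<union> uminus ` W) = W \<union> uminus ` W"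
      by (auto simp: image_Un image_image)
  qed (use VW in auto)
qed

section \<open>Uniqueness of invariant measures on compact sets\<close>

text \<open>The part of the definition of a Haar measure that its uniqueness on compact sets rests on. Outer
regularity is only asked for at compact sets, because this is what \<open>A \<mapsto> \<rho>(A \<times> B)\<close> and the image of
\<open>\<rho>\<close> under the exchange of coordinates visibly inherit from \<open>\<rho>\<close>.\<close>

definition right_radon :: "'a::topological_group measure \<Rightarrow> bool" where
  "right_radon \<mu> \<longleftrightarrow>
     sets \<mu> = sets borel \<and>
     (\<forall>K. compact K \<longrightarrow> emeasure \<mu> K < \<infinity>) \<and>
     (\<forall>g. \<forall>A\<in>sets borel. emeasure \<mu> ((\<lambda>a. a + g) ` A) = emeasure \<mu> A) \<and>
     (\<forall>K e. compact K \<and> (0::real) < e \<longrightarrow>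
        (\<exists>U. open U \<and> K \<subseteq> U \<and> emeasure \<mu> U \<le> emeasure \<mu> K + ennreal e))"

lemma right_radon_translate:
  assumes "right_radon \<mu>" "A \<in> sets borel"
  shows "emeasure \<mu> ((\<lambda>a. a + g) ` A) = emeasure \<mu> A"
  using assms by (simp add: right_radon_def)

lemma right_radon_outer:
  assumes "right_radon \<mu>" "compact K" "0 < e"
  shows "\<exists>U. open U \<and> K \<subseteq> U \<and> emeasure \<mu> U \<le> emeasure \<mu> K + ennreal e"
  using assms by (simp add: right_radon_def)

lemma haar_measure_right_radon:
  assumes "haar_measure \<mu>"
  shows "right_radon \<mu>"
  unfolding right_radon_def
proof (intro conjI allI impI ballI)
  fix K :: "'a set" and e :: real
  assume Ke: "compact K \<and> 0 < e"
  have reg: "regular_borel_measure \<mu>"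
    using assms by (simp add: haar_measure_def)
  then have "emeasure \<mu> K < \<infinity>"
    using Ke by (simp add: regular_borel_measure_def)
  then have "emeasure \<mu> K < emeasure \<mu> K + ennreal e"
    using Ke by (simp add: ennreal_add_left_cancel_less[of _ 0, simplified])
  moreover have "emeasure \<mu> K = (INF U\<in>{U. open U \<and> K \<subseteq> U}. emeasure \<mu> U)"
    using reg Ke borel_compact unfolding regular_borel_measure_def by blast
  ultimately obtain U where "open U" "K \<subseteq> U" "emeasure \<mu> U < emeasure \<mu> K + ennreal e"
    by (auto simp: INF_less_iff)
  then show "\<exists>U. open U \<and> K \<subseteq> U \<and> emeasure \<mu> U \<le> emeasure \<mu> K + ennreal e"
    by (auto intro: less_imp_le)
qed (use assms in \<open>auto simp: haar_measure_def regular_borel_measure_def\<close>)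

lemma emeasure_eq_measure_compact:
  assumes "right_radon \<mu>" "compact K"
  shows "emeasure \<mu> K = ennreal (measure \<mu> K)"
  using assms by (intro emeasure_eq_ennreal_measure) (auto simp: right_radon_def)

lemma measure_mono_compact:
  assumes "right_radon \<mu>" "compact K" "S \<subseteq> K"
  shows "measure \<mu> S \<le> measure \<mu> K"
proof -
  have "K \<in> sets \<mu>" "emeasure \<mu> K < \<infinity>"
    using assms by (auto simp: right_radon_def intro: borel_compact)
  then show ?thesis
    using assms(3) emeasure_mono[of S K \<mu>]
    by (auto simp: measure_def intro!: enn2real_mono)
qed

lemma compact_outer_approximation:
  assumes "right_radon \<mu>" "compact K" "0 < e"
  obtains U where "open U" "K \<subseteq> U" "emeasure \<mu> U \<le> ennreal (measure \<mu> K + e)"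
proof -
  obtain U where "open U" "K \<subseteq> U" "emeasure \<mu> U \<le> emeasure \<mu> K + ennreal e"
    using right_radon_outer[OF assms] by blast
  then show ?thesis
    using that emeasure_eq_measure_compact[OF assms(1,2)] assms(3) by simp
qed

text \<open>With Fubini's theorem this would be the integral of \<open>[y - x \<in> W]\<close> over \<open>y \<in> A\<close> and
\<open>x \<in> -W + A\<close>, computed in two ways: for fixed \<open>y\<close> the set of \<open>x\<close> is \<open>-W + y\<close>, and for fixed \<open>x\<close> the
set of \<open>y\<close> is contained in \<open>W + x\<close>. To exchange only a finite sum with an integral, the set \<open>E = -W + A\<close> is
partitioned into small Borel pieces \<open>D k\<close>, and all points of \<open>D k\<close> are replaced by one point \<open>c k\<close>.
The price is that \<open>W\<close> grows to the open set \<open>V\<close>.\<close>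

lemma double_counting_open:
  fixes \<mu> \<kappa> :: "'a::topological_group measure"
  assumes \<kappa>: "right_radon \<kappa>" and \<mu>: "right_radon \<mu>"
    and A: "compact A" and W: "compact W" and V: "open V" "W \<subseteq> V"
  shows "emeasure \<kappa> (uminus ` W) * emeasure \<mu> A
       \<le> emeasure \<mu> V * emeasure \<kappa> (uminus ` W + A)"
proof -
  define E where "E = uminus ` W + A"
  have E: "compact E"
    unfolding E_def by (intro compact_set_plus compact_uminus A W)
  have s\<kappa>: "sets \<kappa> = sets borel" and smu: "sets \<mu> = sets borel"
    using \<kappa> \<mu> by (auto simp: right_radon_def)
  have bE: "E \<in> sets \<kappa>" and bA: "A \<in> sets \<mu>" and bW: "uminus ` W \<in> sets borel"
    using E A W by (auto simp: s\<kappa> smu intro!: borel_compact compact_uminus)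
  \<comment> \<open>\<open>U\<close> is the admissible error in \<open>x\<close>: if \<open>y - x \<in> W\<close> and \<open>x - c k \<in> U\<close>, then \<open>y - c k \<in> V\<close>.\<close>
  obtain U where U: "open U" "0 \<in> U" "W + U \<subseteq> V"
    using compact_plus_nbhd[OF W V] by blast
  have "E \<subseteq> (\<Union>x\<in>E. (\<lambda>a. a + x) ` U)"
    using U(2) by force
  then obtain C where C: "C \<subseteq> E" "finite C" "E \<subseteq> (\<Union>x\<in>C. (\<lambda>a. a + x) ` U)"
    using compactE_image[OF E, of E "\<lambda>x. (\<lambda>a. a + x) ` U"] U(1) open_translate by metis
  obtain n and c :: "nat \<Rightarrow> 'a" where c: "C = c ` {..<n}"
    using C(2) unfolding finite_conv_nat_seg_image lessThan_def by blast
  define D where "D = disjointed (\<lambda>k. E \<inter> (\<lambda>a. a + c k) ` U)"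
  have D_sub: "D k \<subseteq> E \<inter> (\<lambda>a. a + c k) ` U" for k
    by (auto simp: D_def disjointed_def)
  have D_Un: "(\<Union>k<n. D k) = E"
    using finite_UN_disjointed_eq[of "\<lambda>k. E \<inter> (\<lambda>a. a + c k) ` U" n] C(3)
    by (auto simp: D_def c atLeast0LessThan)
  have D_dis: "disjoint_family_on D K" for K
    using disjoint_family_disjointed[of "\<lambda>k. E \<inter> (\<lambda>a. a + c k) ` U"]
    by (auto simp: D_def disjoint_family_on_def)
  have bD: "D k \<in> sets \<kappa>" for k
    unfolding D_def disjointed_def using bE
    by (intro sets.Diff sets.finite_UN sets.Int) (auto simp: s\<kappa> intro!: borel_translate borel_open open_translate U)
  let ?V = "\<lambda>k. (\<lambda>a. a + c k) ` V"
  have bV: "?V k \<in> sets \<mu>" for k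
    by (simp add: smu borel_translate borel_open V)
  \<comment> \<open>Every \<open>x \<in> -W + y\<close> lies in a piece whose centre \<open>c k\<close> satisfies \<open>y - c k \<in> V\<close>.\<close>
  have pw: "emeasure \<kappa> (uminus ` W) * indicator A y
      \<le> (\<Sum>k<n. emeasure \<kappa> (D k) * indicator (A \<inter> ?V k) y)" for y
  proof (cases "y \<in> A")
    case True
    let ?J = "{k. k < n \<and> y \<in> ?V k}"
    have sub: "(\<lambda>a. a + y) ` uminus ` W \<subseteq> (\<Union>k\<in>?J. D k)"
    proof
      fix x assume "x \<in> (\<lambda>a. a + y) ` uminus ` W"
      then obtain w where w: "w \<in> W" "x = - w + y"
        by auto
      then have "x \<in> E"
        using True unfolding E_def by blast
      then obtain k where k: "k < n" "x \<in> D k"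
        using D_Un by blast
      then obtain u where u: "u \<in> U" "x = u + c k"
        using D_sub by blast
      have "y = w + x"
        using w by (simp add: add.assoc[symmetric])
      then have "y = (w + u) + c k"
        using u by (simp add: add.assoc)
      moreover have "w + u \<in> V"
        using U(3) w(1) u(1) by blast
      ultimately show "x \<in> (\<Union>k\<in>?J. D k)"
        using k by blast
    qed
    have "emeasure \<kappa> (uminus ` W) = emeasure \<kappa> ((\<lambda>a. a + y) ` uminus ` W)"
      using \<kappa> bW by (simp add: right_radon_def)
    also have "\<dots> \<le> emeasure \<kappa> (\<Union>k\<in>?J. D k)"
      by (intro emeasure_mono sub sets.finite_UN) (auto simp: bD)
    also have "\<dots> = (\<Sum>k\<in>?J. emeasure \<kappa> (D k))"
      by (intro sum_emeasure[symmetric] D_dis) (auto simp: bD)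
    also have "\<dots> = (\<Sum>k<n. emeasure \<kappa> (D k) * indicator (A \<inter> ?V k) y)"
      using True by (intro sum.mono_neutral_cong_left) (auto simp: indicator_def)
    finally show ?thesis
      using True by simp
  qed simp
  have "emeasure \<kappa> (uminus ` W) * emeasure \<mu> A
      = (\<integral>\<^sup>+y. emeasure \<kappa> (uminus ` W) * indicator A y \<partial>\<mu>)"
    using bA by (simp add: nn_integral_cmult_indicator)
  also have "\<dots> \<le> (\<integral>\<^sup>+y. (\<Sum>k<n. emeasure \<kappa> (D k) * indicator (A \<inter> ?V k) y) \<partial>\<mu>)"
    by (intro nn_integral_mono pw)
  also have "\<dots> = (\<Sum>k<n. emeasure \<kappa> (D k) * emeasure \<mu> (A \<inter> ?V k))"
    using bA bV by (subst nn_integral_sum)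
      (auto intro!: sum.cong nn_integral_cmult_indicator borel_measurable_times borel_measurable_indicator)
  also have "\<dots> \<le> (\<Sum>k<n. emeasure \<kappa> (D k) * emeasure \<mu> V)"
  proof (intro sum_mono mult_left_mono)
    fix k
    have "emeasure \<mu> (A \<inter> ?V k) \<le> emeasure \<mu> (?V k)"
      by (intro emeasure_mono bV) auto
    also have "\<dots> = emeasure \<mu> V"
      using \<mu> V by (simp add: right_radon_def)
    finally show "emeasure \<mu> (A \<inter> ?V k) \<le> emeasure \<mu> V" .
  qed simp
  also have "\<dots> = emeasure \<mu> V * (\<Sum>k<n. emeasure \<kappa> (D k))"
    by (simp add: sum_distrib_left mult.commute)
  also have "(\<Sum>k<n. emeasure \<kappa> (D k)) = emeasure \<kappa> E"
    using D_Un by (subst sum_emeasure) (auto simp: bD D_dis)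
  finally show ?thesis
    unfolding E_def .
qed

lemma le_mult_if_le_mult_plus:
  fixes a b c :: real
  assumes "\<And>e. 0 < e \<Longrightarrow> a \<le> (b + e) * (c + e)"
  shows "a \<le> b * c"
proof (rule tendsto_lowerbound)
  show "((\<lambda>e. (b + e) * (c + e)) \<longlongrightarrow> b * c) (at_right 0)"
    by (auto intro!: tendsto_eq_intros)
  show "eventually (\<lambda>e. a \<le> (b + e) * (c + e)) (at_right 0)"
    using assms by (auto simp: eventually_at_right_field intro: exI[of _ 1])
qed simp

text \<open>Outer regularity of \<open>\<mu>\<close> at \<open>W\<close> removes the enlargement of \<open>W\<close>.\<close>

lemma double_counting:
  fixes \<mu> \<kappa> :: "'a::topological_group measure"
  assumes \<kappa>: "right_radon \<kappa>" and \<mu>: "right_radon \<mu>"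
    and A: "compact A" and W: "compact W"
  shows "measure \<kappa> (uminus ` W) * measure \<mu> A \<le> measure \<mu> W * measure \<kappa> (uminus ` W + A)"
proof (rule le_mult_if_le_mult_plus)
  fix e :: real assume e: "0 < e"
  obtain V where V: "open V" "W \<subseteq> V" "emeasure \<mu> V \<le> ennreal (measure \<mu> W + e)"
    using compact_outer_approximation[OF \<mu> W e] by blast
  have cW: "compact (uminus ` W)" and cE: "compact (uminus ` W + A)"
    by (intro compact_set_plus compact_uminus A W)+
  have "emeasure \<kappa> (uminus ` W) * emeasure \<mu> A
      \<le> ennreal (measure \<mu> W + e) * emeasure \<kappa> (uminus ` W + A)"
    using double_counting_open[OF \<kappa> \<mu> A W V(1,2)] mult_right_mono[OF V(3)]
    by (metis (no_types) order_trans zero_le)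
  then have "measure \<kappa> (uminus ` W) * measure \<mu> A
      \<le> (measure \<mu> W + e) * measure \<kappa> (uminus ` W + A)"
    using e by (simp add: emeasure_eq_measure_compact[OF \<kappa> cW] emeasure_eq_measure_compact[OF \<kappa> cE]
        emeasure_eq_measure_compact[OF \<mu> A] ennreal_mult[symmetric] del: ennreal_plus)
  also have "\<dots> \<le> (measure \<mu> W + e) * (measure \<kappa> (uminus ` W + A) + e)"
    using e by (intro mult_left_mono) auto
  finally show "measure \<kappa> (uminus ` W) * measure \<mu> A
      \<le> (measure \<mu> W + e) * (measure \<kappa> (uminus ` W + A) + e)" .
qed

text \<open>Otherwise every compact set, being covered by finitely many translates of \<open>U\<close>, would be a null set,
and by inner regularity so would be the whole group.\<close>

lemma haar_measure_open_pos:
  fixes \<mu> :: "'a::topological_group measure"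
  assumes "haar_measure \<mu>" "open U" "U \<noteq> {}"
  shows "emeasure \<mu> U \<noteq> 0"
proof
  assume 0: "emeasure \<mu> U = 0"
  have smu: "sets \<mu> = sets borel"
    using assms by (simp add: haar_measure_def regular_borel_measure_def)
  obtain u where u: "u \<in> U"
    using assms(3) by blast
  have "emeasure \<mu> K = 0" if K: "compact K" for K
  proof -
    have "K \<subseteq> (\<Union>x\<in>K. (\<lambda>a. a + (- u + x)) ` U)"
    proof
      fix x assume "x \<in> K"
      moreover have "x = u + (- u + x)"
        by (simp add: add.assoc[symmetric])
      ultimately show "x \<in> (\<Union>x\<in>K. (\<lambda>a. a + (- u + x)) ` U)"
        using u by blast
    qed
    then obtain C where C: "C \<subseteq> K" "finite C" "K \<subseteq> (\<Union>x\<in>C. (\<lambda>a. a + (- u + x)) ` U)"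
      using compactE_image[OF K, of K "\<lambda>x. (\<lambda>a. a + (- u + x)) ` U"] assms(2) open_translate
      by metis
    have "emeasure \<mu> K \<le> emeasure \<mu> (\<Union>x\<in>C. (\<lambda>a. a + (- u + x)) ` U)"
      using C assms(2)
      by (intro emeasure_mono) (auto simp: smu intro!: borel_open open_UN open_translate)
    also have "\<dots> \<le> (\<Sum>x\<in>C. emeasure \<mu> ((\<lambda>a. a + (- u + x)) ` U))"
      using C assms(2)
      by (intro emeasure_subadditive_finite) (auto simp: smu intro!: borel_open open_translate)
    also have "\<dots> = 0"
      using assms 0 by (simp add: haar_measure_def)
    finally show ?thesis
      by simp
  qed
  then have "(SUP K\<in>{K. compact K \<and> K \<subseteq> UNIV}. emeasure \<mu> K) = 0"
    by (simp add: SUP_eq_const[of _ _ 0] flip: bot_ennreal)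
  then show False
    using assms(1) open_UNIV unfolding haar_measure_def regular_borel_measure_def by metis
qed

lemma haar_measure_pos:
  assumes "haar_measure \<mu>" "compact K" "interior K \<noteq> {}"
  shows "0 < measure \<mu> K"
proof -
  have K: "K \<in> sets \<mu>" "emeasure \<mu> K < \<infinity>"
    using assms by (auto simp: haar_measure_def regular_borel_measure_def intro: borel_compact)
  have "emeasure \<mu> K \<noteq> 0"
    using haar_measure_open_pos[OF assms(1) open_interior assms(3)]
      emeasure_mono[OF interior_subset K(1)] by auto
  then show ?thesis
    using K by (simp add: measure_def enn2real_positive_iff zero_less_iff_neq_zero)
qed

text \<open>Write \<open>\<kappa>(W)\<close> and \<open>\<mu>(W)\<close> for a symmetric neighbourhood \<open>W\<close> of \<open>0\<close>. Double counting in both directions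
gives \<open>\<mu>(W) \<kappa>(A) \<le> \<kappa>(W) \<mu>(W + A)\<close> and \<open>\<kappa>(W) \<mu>(B) \<le> \<mu>(W) \<kappa>(W + B)\<close>. Multiplying them eliminates
\<open>\<kappa>(W)\<close>, and \<open>\<mu>(W)\<close> cancels because it is positive. What remains is
\<open>\<kappa>(A) \<mu>(B) \<le> \<kappa>(W + B) \<mu>(W + A)\<close>, and \<open>W\<close> can be taken arbitrarily small.\<close>

lemma invariant_measure_cross_le:
  fixes \<mu> \<kappa> :: "'a::topological_group measure"
  assumes lc: "locally_compact_space (euclidean :: 'a topology)"
    and \<mu>: "haar_measure \<mu>" and \<kappa>: "right_radon \<kappa>"
    and A: "compact A" and B: "compact B"
  shows "measure \<kappa> A * measure \<mu> B \<le> measure \<kappa> B * measure \<mu> A"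
proof (rule le_mult_if_le_mult_plus)
  fix e :: real assume e: "0 < e"
  have \<mu>': "right_radon \<mu>"
    using \<mu> by (rule haar_measure_right_radon)
  obtain S where S: "open S" "B \<subseteq> S" "emeasure \<kappa> S \<le> ennreal (measure \<kappa> B + e)"
    using compact_outer_approximation[OF \<kappa> B e] by blast
  obtain T where T: "open T" "A \<subseteq> T" "emeasure \<mu> T \<le> ennreal (measure \<mu> A + e)"
    using compact_outer_approximation[OF \<mu>' A e] by blast
  obtain S' where S': "open S'" "0 \<in> S'" "S' + B \<subseteq> S"
    using nbhd_plus_compact[OF B S(1,2)] by blast
  obtain T' where T': "open T'" "0 \<in> T'" "T' + A \<subseteq> T"
    using nbhd_plus_compact[OF A T(1,2)] by blast
  obtain V W where W: "open V" "compact W" "0 \<in> V" "V \<subseteq> W" "W \<subseteq> S' \<inter> T'" "uminus ` W = W"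
    using symmetric_compact_nbhd[OF lc, of "S' \<inter> T'"] S' T' by auto
  have "V \<subseteq> interior W"
    using W by (simp add: interior_maximal)
  then have pos: "0 < measure \<mu> W"
    using W by (intro haar_measure_pos \<mu>) auto
  have cWB: "compact (W + B)" and cWA: "compact (W + A)"
    by (intro compact_set_plus W A B)+
  have "emeasure \<kappa> (W + B) \<le> emeasure \<kappa> S"
    using W S S' \<kappa> by (intro emeasure_mono order_trans[OF set_plus_mono2 S'(3)])
      (auto simp: right_radon_def)
  then have "emeasure \<kappa> (W + B) \<le> ennreal (measure \<kappa> B + e)"
    using S(3) by (rule order_trans)
  then have WB: "measure \<kappa> (W + B) \<le> measure \<kappa> B + e"
    using e by (simp add: emeasure_eq_measure_compact[OF \<kappa> cWB] del: ennreal_plus)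
  have "emeasure \<mu> (W + A) \<le> emeasure \<mu> T"
    using W T T' \<mu>' by (intro emeasure_mono order_trans[OF set_plus_mono2 T'(3)])
      (auto simp: right_radon_def)
  then have "emeasure \<mu> (W + A) \<le> ennreal (measure \<mu> A + e)"
    using T(3) by (rule order_trans)
  then have WA: "measure \<mu> (W + A) \<le> measure \<mu> A + e"
    using e by (simp add: emeasure_eq_measure_compact[OF \<mu>' cWA] del: ennreal_plus)
  have "measure \<mu> W * (measure \<kappa> A * measure \<mu> B)
      \<le> (measure \<kappa> W * measure \<mu> (W + A)) * measure \<mu> B"
    using mult_right_mono[OF double_counting[OF \<mu>' \<kappa> A W(2)], of "measure \<mu> B"] W(6)
    by (simp add: mult.assoc)
  also have "\<dots> = (measure \<kappa> W * measure \<mu> B) * measure \<mu> (W + A)"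
    by (simp add: mult_ac)
  also have "\<dots> \<le> (measure \<mu> W * measure \<kappa> (W + B)) * measure \<mu> (W + A)"
    using double_counting[OF \<kappa> \<mu>' B W(2)] W(6) by (intro mult_right_mono) auto
  finally have "measure \<kappa> A * measure \<mu> B \<le> measure \<kappa> (W + B) * measure \<mu> (W + A)"
    using pos by (simp add: mult.assoc)
  also have "\<dots> \<le> (measure \<kappa> B + e) * (measure \<mu> A + e)"
    using WA WB e by (intro mult_mono) auto
  finally show "measure \<kappa> A * measure \<mu> B \<le> (measure \<kappa> B + e) * (measure \<mu> A + e)" .
qed

lemma invariant_measure_unique:
  fixes \<mu> \<kappa> :: "'a::topological_group measure"
  assumes "locally_compact_space (euclidean :: 'a topology)"
    and "haar_measure \<mu>" "right_radon \<kappa>" "compact A" "compact B"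
  shows "measure \<kappa> A * measure \<mu> B = measure \<kappa> B * measure \<mu> A"
  using assms by (intro antisym invariant_measure_cross_le)

section \<open>Haar measures of rectangles\<close>

lemma section_measure_emeasure:
  fixes \<rho> :: "('g::topological_group \<times> 'h::topological_group) measure"
  assumes "sets \<rho> = sets borel" "compact B" "A \<in> sets borel"
  shows "emeasure (distr (density \<rho> (indicator (UNIV \<times> B))) borel fst) A = emeasure \<rho> (A \<times> B)"
proof -
  have fst: "(fst :: 'g \<times> 'h \<Rightarrow> 'g) \<in> borel_measurable borel"
    by (intro borel_measurable_continuous_onI continuous_intros)
  have B: "UNIV \<times> B \<in> sets \<rho>"
    unfolding assms(1) by (intro borel_closed closed_Times closed_UNIV compact_imp_closed assms)
  have A: "fst -` A \<in> sets \<rho>"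
    using measurable_sets[OF fst assms(3)] assms(1) by simp
  have sp: "space \<rho> = UNIV"
    using sets_eq_imp_space_eq[OF assms(1)] by simp
  have "emeasure (distr (density \<rho> (indicator (UNIV \<times> B))) borel fst) A
      = emeasure (density \<rho> (indicator (UNIV \<times> B))) (fst -` A)"
    using fst assms by (subst emeasure_distr) (simp_all add: sp cong: measurable_cong_sets)
  also have "\<dots> = emeasure \<rho> ((UNIV \<times> B) \<inter> fst -` A)"
    by (rule emeasure_restricted[OF B A])
  also have "(UNIV \<times> B) \<inter> fst -` A = A \<times> B"
    by auto
  finally show ?thesis .
qed

text \<open>Translation by \<open>g\<close> in the first factor is translation by \<open>(g, 0)\<close> in the product, and an open set around
the compact rectangle \<open>K \<times> B\<close> contains \<open>U \<times> B\<close> for some open \<open>U\<close> around \<open>K\<close>.\<close>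

lemma section_measure_right_radon:
  fixes \<rho> :: "('g::topological_group \<times> 'h::topological_group) measure"
  assumes \<rho>: "right_radon \<rho>" and B: "compact B"
  shows "right_radon (distr (density \<rho> (indicator (UNIV \<times> B))) borel fst)" (is "right_radon ?\<kappa>")
proof -
  have s: "sets \<rho> = sets borel"
    using \<rho> by (simp add: right_radon_def)
  note em = section_measure_emeasure[OF s B]
  show ?thesis
    unfolding right_radon_def
  proof (intro conjI allI impI ballI)
    fix K :: "'g set" assume "compact K"
    then show "emeasure ?\<kappa> K < \<infinity>"
      using \<rho> B compact_Times[of K B] by (simp add: em borel_compact right_radon_def)
  next
    fix g :: 'g and A :: "'g set" assume A: "A \<in> sets borel"
    have "(fst :: 'g \<times> 'h \<Rightarrow> 'g) \<in> borel_measurable borel" "(snd :: 'g \<times> 'h \<Rightarrow> 'h) \<in> borel_measurable borel"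
      by (intro borel_measurable_continuous_onI continuous_intros)+
    then have "(fst :: 'g \<times> 'h \<Rightarrow> 'g) -` A \<inter> (snd :: 'g \<times> 'h \<Rightarrow> 'h) -` B \<in> sets borel"
      using A B borel_compact measurable_sets[of _ borel borel] by (metis Int_UNIV_right sets.Int space_borel)
    moreover have "(fst :: 'g \<times> 'h \<Rightarrow> 'g) -` A \<inter> (snd :: 'g \<times> 'h \<Rightarrow> 'h) -` B = A \<times> B"
      by auto
    ultimately have AB: "A \<times> B \<in> sets borel"
      by simp
    have "((\<lambda>a. a + g) ` A) \<times> B = (\<lambda>p. p + (g, 0)) ` (A \<times> B)"
      by force
    then show "emeasure ?\<kappa> ((\<lambda>a. a + g) ` A) = emeasure ?\<kappa> A"
      using \<rho> A AB by (simp add: em borel_translate right_radon_def)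
  next
    fix K :: "'g set" and e :: real assume "compact K \<and> 0 < e"
    then have K: "compact K" "0 < e"
      by auto
    obtain W where W: "open W" "K \<times> B \<subseteq> W" "emeasure \<rho> W \<le> emeasure \<rho> (K \<times> B) + ennreal e"
      using right_radon_outer[OF \<rho> compact_Times[OF K(1) B] K(2)] by blast
    obtain U V where UV: "open U" "K \<subseteq> U" "B \<subseteq> V" "U \<times> V \<subseteq> W"
      using compact_tube[OF K(1) B W(1,2)] by metis
    have "emeasure \<rho> (U \<times> B) \<le> emeasure \<rho> W"
      using UV W by (intro emeasure_mono) (auto simp: s)
    then show "\<exists>U. open U \<and> K \<subseteq> U \<and> emeasure ?\<kappa> U \<le> emeasure ?\<kappa> K + ennreal e"
      using UV W K by (intro exI[of _ U]) (simp add: em borel_compact)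
  qed simp
qed

lemma continuous_on_swap: "continuous_on S (prod.swap :: 'a::topological_space \<times> 'b::topological_space \<Rightarrow> _)"
  unfolding prod.swap_def by (intro continuous_intros)

lemma compact_swap:
  fixes C :: "('a::topological_space \<times> 'b::topological_space) set"
  shows "compact C \<Longrightarrow> compact (prod.swap ` C)"
  by (intro compact_continuous_image continuous_on_swap)

lemma swap_vimage: "prod.swap -` A = prod.swap ` A"
  by force

lemma open_swap:
  fixes C :: "('a::topological_space \<times> 'b::topological_space) set"
  shows "open C \<Longrightarrow> open (prod.swap ` C)"
  unfolding swap_vimage[symmetric] by (intro open_vimage continuous_on_swap)

lemma swap_plus: "prod.swap (p + q) = prod.swap p + prod.swap q"
  by (cases p; cases q; simp)

text \<open>Exchanging coordinates lets the second factor be handled by results about the first one.\<close>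

lemma right_radon_swap:
  fixes \<rho> :: "('g::topological_group \<times> 'h::topological_group) measure"
  assumes \<rho>: "right_radon \<rho>"
  shows "right_radon (distr \<rho> borel prod.swap)" (is "right_radon ?\<kappa>")
    and "A \<in> sets borel \<Longrightarrow> emeasure (distr \<rho> borel prod.swap) A = emeasure \<rho> (prod.swap ` A)"
proof -
  have s: "sets \<rho> = sets borel"
    using \<rho> by (simp add: right_radon_def)
  have sp: "space \<rho> = UNIV"
    using sets_eq_imp_space_eq[OF s] by simp
  have sw: "(prod.swap :: 'g \<times> 'h \<Rightarrow> _) \<in> borel_measurable borel"
    by (intro borel_measurable_continuous_onI continuous_on_swap)
  have em: "emeasure ?\<kappa> A = emeasure \<rho> (prod.swap ` A)" if "A \<in> sets borel" for A
    using sw that s by (subst emeasure_distr) (simp_all add: sp swap_vimage cong: measurable_cong_sets)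
  have bs: "prod.swap ` A \<in> sets borel" if "A \<in> sets borel" for A :: "('h \<times> 'g) set"
    using measurable_sets[OF sw that] by (simp add: swap_vimage)
  show "right_radon ?\<kappa>"
    unfolding right_radon_def
  proof (intro conjI allI impI ballI)
    fix K :: "('h \<times> 'g) set" assume K: "compact K"
    then show "emeasure ?\<kappa> K < \<infinity>"
      using \<rho> compact_swap[OF K] by (simp add: em borel_compact right_radon_def)
  next
    fix g and A :: "('h \<times> 'g) set" assume A: "A \<in> sets borel"
    have "prod.swap ` ((\<lambda>a. a + g) ` A) = (\<lambda>p. p + prod.swap g) ` (prod.swap ` A)"
      by (simp add: image_image swap_plus)
    then show "emeasure ?\<kappa> ((\<lambda>a. a + g) ` A) = emeasure ?\<kappa> A"
      using A by (simp add: em borel_translate right_radon_translate[OF \<rho> bs[OF A]])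
  next
    fix K :: "('h \<times> 'g) set" and e :: real assume K: "compact K \<and> 0 < e"
    then obtain W where W: "open W" "prod.swap ` K \<subseteq> W"
        "emeasure \<rho> W \<le> emeasure \<rho> (prod.swap ` K) + ennreal e"
      using right_radon_outer[OF \<rho> compact_swap] by blast
    have "K \<subseteq> prod.swap ` W"
      using W(2) by force
    then show "\<exists>U. open U \<and> K \<subseteq> U \<and> emeasure ?\<kappa> U \<le> emeasure ?\<kappa> K + ennreal e"
      using W K open_swap[OF W(1)]
      by (intro exI[of _ "prod.swap ` W"]) (simp add: em borel_compact image_image)
  qed simp
  show "A \<in> sets borel \<Longrightarrow> emeasure (distr \<rho> borel prod.swap) A = emeasure \<rho> (prod.swap ` A)"
    by (rule em)
qed

lemma rectangle_first_factor:
  fixes \<mu> :: "'g::topological_group measure" and \<rho> :: "('g \<times> 'h::topological_group) measure"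
  assumes "locally_compact_space (euclidean :: 'g topology)"
    and "haar_measure \<mu>" and \<rho>: "right_radon \<rho>"
    and "compact A" "compact A'" "compact B"
  shows "measure \<rho> (A \<times> B) * measure \<mu> A' = measure \<rho> (A' \<times> B) * measure \<mu> A"
proof -
  have "sets \<rho> = sets borel"
    using \<rho> by (simp add: right_radon_def)
  from section_measure_emeasure[OF this \<open>compact B\<close>]
  have "measure (distr (density \<rho> (indicator (UNIV \<times> B))) borel fst) K = measure \<rho> (K \<times> B)"
    if "compact K" for K
    using that by (simp add: measure_def borel_compact)
  then show ?thesis
    using invariant_measure_unique[OF assms(1,2) section_measure_right_radon[OF \<rho> assms(6)] assms(4,5)]
      assms(4,5) by simp
qed

text \<open>By uniqueness, \<open>\<rho>(S \<times> T)\<close> is proportional to \<open>\<mu>(S)\<close> for fixed \<open>T\<close> and proportional to \<open>\<nu>(T)\<close> for fixed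
\<open>S\<close>. Evaluating at one rectangle \<open>A \<times> B\<close> with non-empty interior determines the constant and shows that
it is positive.\<close>

lemma haar_measure_rectangle:
  fixes \<mu> :: "'g::topological_group measure" and \<nu> :: "'h::topological_group measure"
    and \<rho> :: "('g \<times> 'h) measure"
  assumes lcG: "locally_compact_space (euclidean :: 'g topology)" and \<mu>: "haar_measure \<mu>"
    and lcH: "locally_compact_space (euclidean :: 'h topology)" and \<nu>: "haar_measure \<nu>"
    and \<rho>: "haar_measure \<rho>"
  obtains c where "0 < c"
    "\<And>A B. compact A \<Longrightarrow> compact B \<Longrightarrow> measure \<rho> (A \<times> B) = c * (measure \<mu> A * measure \<nu> B)"
proof -
  obtain V A where A: "open V" "compact A" "(0::'g) \<in> V" "V \<subseteq> A"
    using compact_nbhd_within[OF lcG open_UNIV, of 0] by auto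
  obtain W B where B: "open W" "compact B" "(0::'h) \<in> W" "W \<subseteq> B"
    using compact_nbhd_within[OF lcH open_UNIV, of 0] by auto
  have "V \<subseteq> interior A" "W \<subseteq> interior B"
    using A B by (simp_all add: interior_maximal)
  then have iA: "interior A \<noteq> {}" and iB: "interior B \<noteq> {}"
    and iAB: "interior (A \<times> B) \<noteq> {}"
    using A B by (auto simp: interior_Times)
  have pA: "0 < measure \<mu> A" and pB: "0 < measure \<nu> B" and pAB: "0 < measure \<rho> (A \<times> B)"
    by (intro haar_measure_pos \<mu> \<nu> \<rho> A B iA iB iAB compact_Times)+
  have \<rho>': "right_radon \<rho>"
    using \<rho> by (rule haar_measure_right_radon)
  \<comment> \<open>The exchange of coordinates turns the fixed set \<open>A\<close> into the second factor.\<close>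
  have second: "measure \<rho> (A \<times> T) * measure \<nu> B = measure \<rho> (A \<times> B) * measure \<nu> T"
    if T: "compact T" for T
  proof -
    have "prod.swap ` (X \<times> Y) = Y \<times> X" for X :: "'h set" and Y :: "'g set"
      by force
    then have "measure (distr \<rho> borel prod.swap) (X \<times> A) = measure \<rho> (A \<times> X)" if "compact X" for X
      using right_radon_swap(2)[OF \<rho>', of "X \<times> A"] that A(2)
      by (simp add: measure_def borel_compact compact_Times)
    then show ?thesis
      using rectangle_first_factor[OF lcH \<nu> right_radon_swap(1)[OF \<rho>'] T B(2) A(2)] T B(2) by simp
  qed
  show ?thesis
  proof (rule that[of "measure \<rho> (A \<times> B) / (measure \<mu> A * measure \<nu> B)"])
    show "0 < measure \<rho> (A \<times> B) / (measure \<mu> A * measure \<nu> B)"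
      using pA pB pAB by simp
    fix S T assume S: "compact (S :: 'g set)" and T: "compact (T :: 'h set)"
    have "measure \<rho> (S \<times> T) * measure \<mu> A * measure \<nu> B
        = measure \<rho> (A \<times> T) * measure \<nu> B * measure \<mu> S"
      using rectangle_first_factor[OF lcG \<mu> \<rho>' S A(2) T] by simp
    also have "\<dots> = measure \<rho> (A \<times> B) * measure \<nu> T * measure \<mu> S"
      by (simp add: second[OF T])
    finally show "measure \<rho> (S \<times> T)
        = measure \<rho> (A \<times> B) / (measure \<mu> A * measure \<nu> B) * (measure \<mu> S * measure \<nu> T)"
      using pA pB by (simp add: field_simps)
  qed
qed

section \<open>Products of Van Hove nets\<close>

definition product_order :: "'i rel \<Rightarrow> 'j rel \<Rightarrow> ('i \<times> 'j) rel" where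
  "product_order r s = {((i, j), (i', j')). (i, i') \<in> r \<and> (j, j') \<in> s}"

lemma directed_set_product:
  assumes I: "directed_set I r" and J: "directed_set J s"
  shows "directed_set (I \<times> J) (product_order r s)"
  unfolding directed_set_def
proof (intro conjI allI impI)
  show "I \<times> J \<noteq> {}"
    using I J by (auto simp: directed_set_def)
  have r: "partial_order_on I r" and s: "partial_order_on J s"
    using I J by (auto simp: directed_set_def)
  show "partial_order_on (I \<times> J) (product_order r s)"
    unfolding partial_order_on_def preorder_on_def
  proof (intro conjI)
    show "product_order r s \<subseteq> (I \<times> J) \<times> (I \<times> J)" "refl_on (I \<times> J) (product_order r s)"
      using partial_order_onD(1)[OF r] partial_order_onD(1)[OF s] r s
      by (auto simp: product_order_def refl_on_def partial_order_on_def preorder_on_def)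
    show "trans (product_order r s)"
      using partial_order_onD(2)[OF r] partial_order_onD(2)[OF s]
      by (auto simp: product_order_def trans_def; blast)
    show "antisym (product_order r s)"
      using partial_order_onD(3)[OF r] partial_order_onD(3)[OF s]
      by (auto simp: product_order_def antisym_def)
  qed
next
  fix F assume F: "finite F \<and> F \<subseteq> I \<times> J"
  then have "finite (fst ` F)" "fst ` F \<subseteq> I" "finite (snd ` F)" "snd ` F \<subseteq> J"
    by auto
  then obtain u v where "u \<in> I" "\<forall>x\<in>fst ` F. (x, u) \<in> r" "v \<in> J" "\<forall>x\<in>snd ` F. (x, v) \<in> s"
    using I J unfolding directed_set_def by metis
  then show "\<exists>w\<in>I \<times> J. \<forall>x\<in>F. (x, w) \<in> product_order r s"
    by (intro bexI[of _ "(u, v)"]) (force simp: product_order_def)+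
qed

lemma directed_set_refl:
  assumes "directed_set I r" "i \<in> I"
  shows "(i, i) \<in> r"
  using assms by (auto simp: directed_set_def refl_on_def dest: partial_order_onD(1))

lemma net_filter_not_bot:
  assumes "directed_set I r"
  shows "net_filter I r \<noteq> bot"
  using eventually_net_filter[OF assms, of "\<lambda>_. False"] directed_set_refl[OF assms]
  by (auto simp: trivial_limit_def)

lemma eventually_prod_filterI:
  assumes "eventually P F" "eventually Q G" "\<And>x y. P x \<Longrightarrow> Q y \<Longrightarrow> R (x, y)"
  shows "eventually R (F \<times>\<^sub>F G)"
  using assms unfolding eventually_prod_filter by blast

lemma net_filter_product:
  assumes I: "directed_set I r" and J: "directed_set J s"
  shows "net_filter (I \<times> J) (product_order r s) = net_filter I r \<times>\<^sub>F net_filter J s"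
  unfolding filter_eq_iff
proof (intro allI iffI)
  fix P
  assume "eventually P (net_filter (I \<times> J) (product_order r s))"
  then obtain i j where ij: "i \<in> I" "j \<in> J"
    "\<forall>p\<in>I \<times> J. ((i, j), p) \<in> product_order r s \<longrightarrow> P p"
    unfolding eventually_net_filter[OF directed_set_product[OF I J]] by blast
  have "eventually (\<lambda>x. x \<in> I \<and> (i, x) \<in> r) (net_filter I r)"
    "eventually (\<lambda>x. x \<in> J \<and> (j, x) \<in> s) (net_filter J s)"
    using ij by (auto simp: eventually_net_filter[OF I] eventually_net_filter[OF J])
  then show "eventually P (net_filter I r \<times>\<^sub>F net_filter J s)"
    by (rule eventually_prod_filterI) (use ij(3) in \<open>auto simp: product_order_def\<close>)
next
  fix P
  assume "eventually P (net_filter I r \<times>\<^sub>F net_filter J s)"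
  then obtain Q R where "eventually Q (net_filter I r)" "eventually R (net_filter J s)"
    and QR: "\<forall>x y. Q x \<longrightarrow> R y \<longrightarrow> P (x, y)"
    unfolding eventually_prod_filter by blast
  then obtain i j where "i \<in> I" "\<forall>x\<in>I. (i, x) \<in> r \<longrightarrow> Q x" "j \<in> J" "\<forall>x\<in>J. (j, x) \<in> s \<longrightarrow> R x"
    unfolding eventually_net_filter[OF I] eventually_net_filter[OF J] by blast
  then show "eventually P (net_filter (I \<times> J) (product_order r s))"
    unfolding eventually_net_filter[OF directed_set_product[OF I J]] using QR
    by (intro bexI[of _ "(i, j)"]) (auto simp: product_order_def)
qed

text \<open>A limit along a product of nets of a quantity that depends on one index only is a limit along that
net.\<close>

lemma tendsto_prod_filter_fstD:
  assumes "((\<lambda>p. h (fst p)) \<longlongrightarrow> l) (F \<times>\<^sub>F G)" "G \<noteq> bot"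
  shows "(h \<longlongrightarrow> l) F"
  unfolding filterlim_iff
proof (intro allI impI)
  fix P assume "eventually P (nhds l)"
  then have "eventually (\<lambda>p. P (h (fst p))) (F \<times>\<^sub>F G)"
    using assms(1) by (simp add: filterlim_iff)
  then obtain Q R where "eventually Q F" "eventually R G" "\<And>x y. Q x \<Longrightarrow> R y \<Longrightarrow> P (h x)"
    unfolding eventually_prod_filter by auto
  moreover from this(2) obtain y where "R y"
    using assms(2) eventually_happens by blast
  ultimately show "eventually (\<lambda>x. P (h x)) F"
    by (auto elim: eventually_mono)
qed

lemma tendsto_prod_filter_sndD:
  assumes "((\<lambda>p. h (snd p)) \<longlongrightarrow> l) (F \<times>\<^sub>F G)" "F \<noteq> bot"
  shows "(h \<longlongrightarrow> l) G"
  unfolding filterlim_iff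
proof (intro allI impI)
  fix P assume "eventually P (nhds l)"
  then have "eventually (\<lambda>p. P (h (snd p))) (F \<times>\<^sub>F G)"
    using assms(1) by (simp add: filterlim_iff)
  then obtain Q R where "eventually R G" "eventually Q F" "\<And>x y. Q x \<Longrightarrow> R y \<Longrightarrow> P (h y)"
    unfolding eventually_prod_filter by auto
  moreover from this(2) obtain x where "Q x"
    using assms(2) eventually_happens by blast
  ultimately show "eventually (\<lambda>x. P (h x)) G"
    by (auto elim: eventually_mono)
qed

lemma boundary_mono:
  assumes "K \<subseteq> L"
  shows "boundary K A \<subseteq> boundary L A"
  using assms set_plus_mono2[of K L] unfolding boundary_def by blast

lemma compact_boundary:
  assumes "compact K" "compact A"
  shows "compact (boundary K A)"
  unfolding boundary_def using assms
  by (intro compact_Int_closed compact_set_plus closed_compact_plus_closed)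
    (auto simp: compact_imp_closed closure_closed)

text \<open>A point of \<open>K + A\<close> outside \<open>A\<close> is \<open>0 + x\<close> with \<open>x\<close> in the complement; therefore \<open>0\<close> is added to
\<open>K\<close>.\<close>

lemma plus_subset_boundary:
  fixes A :: "'a::topological_group set"
  assumes "closed A"
  shows "K + A \<subseteq> A \<union> boundary (insert 0 K) A"
proof
  fix x assume x: "x \<in> K + A"
  have "x \<in> boundary (insert 0 K) A" if "x \<notin> A"
  proof -
    have "0 + x \<in> insert 0 K + closure (- A)"
      using that closure_subset[of "- A"] by (intro set_plus_intro) auto
    moreover have "x \<in> insert 0 K + closure A"
      using x set_plus_mono2[of K "insert 0 K" A "closure A"] closure_subset[of A] by blast
    ultimately show ?thesis
      by (simp add: boundary_def)
  qed
  then show "x \<in> A \<union> boundary (insert 0 K) A"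
    by blast
qed

text \<open>The complement of a rectangle is \<open>(- A) \<times> UNIV \<union> UNIV \<times> (- B)\<close>, so a point that is close to the
complement is so in one of the two coordinates.\<close>

lemma boundary_Times_subset:
  fixes A :: "'g::topological_group set" and B :: "'h::topological_group set"
  assumes "closed A" "closed B"
  shows "boundary (K \<times> L) (A \<times> B) \<subseteq> boundary K A \<times> (L + B) \<union> (K + A) \<times> boundary L B"
proof
  fix p assume p: "p \<in> boundary (K \<times> L) (A \<times> B)"
  have "- (A \<times> B) = (- A) \<times> UNIV \<union> UNIV \<times> (- B)"
    by auto
  then have cl: "closure (- (A \<times> B)) = closure (- A) \<times> UNIV \<union> UNIV \<times> closure (- B)"
    by (simp add: closure_Times)
  have clA: "closure (A \<times> B) = A \<times> B" "closure A = A" "closure B = B"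
    using assms by (auto simp: closure_Times)
  obtain k l a b where 1: "k \<in> K" "l \<in> L" "a \<in> A" "b \<in> B" "p = (k + a, l + b)"
    using p by (auto simp: boundary_def clA elim!: set_plus_elim)
  have "p \<in> K \<times> L + closure (- (A \<times> B))"
    using p by (simp add: boundary_def)
  then obtain k' l' a' b' where 2: "k' \<in> K" "l' \<in> L" "(a', b') \<in> closure (- (A \<times> B))"
      "p = (k' + a', l' + b')"
    by (auto elim!: set_plus_elim)
  have 3: "k + a \<in> K + A" "l + b \<in> L + B"
    using 1 by auto
  from 2(3) consider "a' \<in> closure (- A)" | "b' \<in> closure (- B)"
    unfolding cl by auto
  then show "p \<in> boundary K A \<times> (L + B) \<union> (K + A) \<times> boundary L B"
  proof cases
    case 1
    then have "fst p \<in> boundary K A"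
      using 2 3 \<open>p = (k + a, l + b)\<close> set_plus_intro[of k' K a' "closure (- A)"]
      by (simp add: boundary_def clA)
    then show ?thesis
      using 3 \<open>p = (k + a, l + b)\<close> by simp
  next
    case 2
    then have "snd p \<in> boundary L B"
      using \<open>l' \<in> L\<close> \<open>p = (k' + a', l' + b')\<close> 3 \<open>p = (k + a, l + b)\<close>
        set_plus_intro[of l' L b' "closure (- B)"]
      by (simp add: boundary_def clA)
    then show ?thesis
      using 3 \<open>p = (k + a, l + b)\<close> by simp
  qed
qed

lemma measure_Un_compact_le:
  assumes "right_radon \<mu>" "compact A" "compact B"
  shows "measure \<mu> (A \<union> B) \<le> measure \<mu> A + measure \<mu> B"
  using assms by (intro measure_Un_le) (auto simp: right_radon_def borel_compact)

lemma measure_plus_le: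
  fixes \<mu> :: "'a::topological_group measure"
  assumes "right_radon \<mu>" "compact K" "compact A"
  shows "measure \<mu> (K + A) \<le> measure \<mu> A + measure \<mu> (boundary (insert 0 K) A)"
proof -
  have c: "compact (boundary (insert 0 K) A)"
    using assms by (intro compact_boundary compact_insert)
  have "measure \<mu> (K + A) \<le> measure \<mu> (A \<union> boundary (insert 0 K) A)"
    using assms c by (intro measure_mono_compact plus_subset_boundary compact_Un) (auto simp: compact_imp_closed)
  also have "\<dots> \<le> measure \<mu> A + measure \<mu> (boundary (insert 0 K) A)"
    using assms c by (intro measure_Un_compact_le)
  finally show ?thesis .
qed

text \<open>For the projections \<open>K1\<close> and \<open>K2\<close> of \<open>K\<close>, the factors \<open>1 + a\<close> and \<open>1 + b\<close> bound the measures of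
\<open>K1 + A\<close> and \<open>K2 + B\<close> relative to those of \<open>A\<close> and \<open>B\<close>. If a denominator vanishes, the left-hand side is \<open>0\<close>.\<close>

lemma boundary_Times_ratio:
  fixes \<mu> :: "'g::topological_group measure" and \<nu> :: "'h::topological_group measure"
    and \<rho> :: "('g \<times> 'h) measure"
  assumes \<mu>: "right_radon \<mu>" and \<nu>: "right_radon \<nu>" and \<rho>: "right_radon \<rho>"
    and c: "0 < c" "\<And>A B. compact A \<Longrightarrow> compact B \<Longrightarrow> measure \<rho> (A \<times> B) = c * (measure \<mu> A * measure \<nu> B)"
    and K: "compact K" and A: "compact A" and B: "compact B"
  defines "a \<equiv> measure \<mu> (boundary (insert 0 (fst ` K)) A) / measure \<mu> A"
    and "b \<equiv> measure \<nu> (boundary (insert 0 (snd ` K)) B) / measure \<nu> B"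
  shows "measure \<rho> (boundary K (A \<times> B)) / measure \<rho> (A \<times> B) \<le> a * (1 + b) + (1 + a) * b"
proof (cases "measure \<mu> A = 0 \<or> measure \<nu> B = 0")
  case True
  then show ?thesis
    using c A B by (auto simp: a_def b_def)
next
  case False
  define K1 K2 where "K1 = fst ` K" and "K2 = snd ` K"
  have K12: "compact K1" "compact K2"
    using K unfolding K1_def K2_def by (auto intro!: compact_continuous_image continuous_intros)
  have clA: "closed A" and clB: "closed B"
    using A B by (auto simp: compact_imp_closed)
  have pos: "0 < measure \<mu> A" "0 < measure \<nu> B"
    using False by (auto simp: less_le)
  let ?dA = "boundary (insert 0 K1) A" and ?dB = "boundary (insert 0 K2) B"
  have cp: "compact ?dA" "compact ?dB" "compact (K1 + A)" "compact (K2 + B)"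
    using K12 A B by (auto intro!: compact_boundary compact_set_plus compact_insert)
  have "boundary K (A \<times> B) \<subseteq> boundary (K1 \<times> K2) (A \<times> B)"
    by (intro boundary_mono) (force simp: K1_def K2_def)
  also have "\<dots> \<subseteq> boundary K1 A \<times> (K2 + B) \<union> (K1 + A) \<times> boundary K2 B"
    by (intro boundary_Times_subset clA clB)
  also have "\<dots> \<subseteq> ?dA \<times> (K2 + B) \<union> (K1 + A) \<times> ?dB"
    using boundary_mono[of K1 "insert 0 K1" A] boundary_mono[of K2 "insert 0 K2" B] by blast
  finally have "measure \<rho> (boundary K (A \<times> B)) \<le> measure \<rho> (?dA \<times> (K2 + B) \<union> (K1 + A) \<times> ?dB)"
    using cp by (intro measure_mono_compact \<rho> compact_Un compact_Times)
  also have "\<dots> \<le> measure \<rho> (?dA \<times> (K2 + B)) + measure \<rho> ((K1 + A) \<times> ?dB)"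
    using cp by (intro measure_Un_compact_le \<rho> compact_Times)
  also have "\<dots> = c * (measure \<mu> ?dA * measure \<nu> (K2 + B) + measure \<mu> (K1 + A) * measure \<nu> ?dB)"
    using cp by (simp add: c distrib_left)
  also have "\<dots> \<le> c * (measure \<mu> ?dA * (measure \<nu> B + measure \<nu> ?dB)
      + (measure \<mu> A + measure \<mu> ?dA) * measure \<nu> ?dB)"
    using c(1) measure_plus_le[OF \<mu> K12(1) A] measure_plus_le[OF \<nu> K12(2) B]
    by (intro mult_left_mono add_mono mult_right_mono) auto
  also have "\<dots> = (a * (1 + b) + (1 + a) * b) * measure \<rho> (A \<times> B)"
    using pos A B by (simp add: a_def b_def c K1_def K2_def field_simps)
  finally show ?thesis
    using pos c A B by (simp add: divide_le_eq)
qed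

lemma van_hove_net_product:
  fixes \<mu> :: "'g::topological_group measure" and \<nu> :: "'h::topological_group measure"
    and \<rho> :: "('g \<times> 'h) measure"
  assumes \<mu>: "right_radon \<mu>" and \<nu>: "right_radon \<nu>" and \<rho>: "right_radon \<rho>"
    and c: "0 < c" "\<And>A B. compact A \<Longrightarrow> compact B \<Longrightarrow> measure \<rho> (A \<times> B) = c * (measure \<mu> A * measure \<nu> B)"
    and A: "van_hove_net \<mu> I r A" and B: "van_hove_net \<nu> J s B"
  shows "van_hove_net \<rho> (I \<times> J) (product_order r s) (\<lambda>p. A (fst p) \<times> B (snd p))"
proof -
  have I: "directed_set I r" and J: "directed_set J s"
    using A B by (auto simp: van_hove_net_def)
  have cA: "compact (A i)" if "i \<in> I" for i
    using A that by (simp add: van_hove_net_def)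
  have cB: "compact (B j)" if "j \<in> J" for j
    using B that by (simp add: van_hove_net_def)
  let ?F = "net_filter I r" and ?G = "net_filter J s"
  have dir: "directed_set (I \<times> J) (product_order r s)"
    by (rule directed_set_product[OF I J])
  have "\<exists>j\<in>I. \<forall>i\<in>I. (j, i) \<in> r \<longrightarrow> interior (A i) \<noteq> {}"
    "\<exists>i\<in>J. \<forall>j\<in>J. (i, j) \<in> s \<longrightarrow> interior (B j) \<noteq> {}"
    using A B by (simp_all add: van_hove_net_def)
  then obtain i0 j0 where ij: "i0 \<in> I" "\<forall>i\<in>I. (i0, i) \<in> r \<longrightarrow> interior (A i) \<noteq> {}"
    "j0 \<in> J" "\<forall>j\<in>J. (j0, j) \<in> s \<longrightarrow> interior (B j) \<noteq> {}"
    by blast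
  have "((\<lambda>p. measure \<rho> (boundary K (A (fst p) \<times> B (snd p))) / measure \<rho> (A (fst p) \<times> B (snd p))) \<longlongrightarrow> 0)
      (net_filter (I \<times> J) (product_order r s))" if K: "compact K" for K
  proof -
    define a where "a i = measure \<mu> (boundary (insert 0 (fst ` K)) (A i)) / measure \<mu> (A i)" for i
    define b where "b j = measure \<nu> (boundary (insert 0 (snd ` K)) (B j)) / measure \<nu> (B j)" for j
    have "compact (fst ` K)" "compact (snd ` K)"
      using K by (auto intro!: compact_continuous_image continuous_intros)
    then have "(a \<longlongrightarrow> 0) ?F" "(b \<longlongrightarrow> 0) ?G"
      using A B compact_insert unfolding van_hove_net_def a_def b_def by auto
    then have ab: "((\<lambda>p. a (fst p)) \<longlongrightarrow> 0) (?F \<times>\<^sub>F ?G)" "((\<lambda>p. b (snd p)) \<longlongrightarrow> 0) (?F \<times>\<^sub>F ?G)"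
      by (auto intro: filterlim_compose[OF _ filterlim_fst] filterlim_compose[OF _ filterlim_snd])
    have lim: "((\<lambda>p. a (fst p) * (1 + b (snd p)) + (1 + a (fst p)) * b (snd p)) \<longlongrightarrow> 0)
        (net_filter (I \<times> J) (product_order r s))"
      unfolding net_filter_product[OF I J] using ab by (auto intro!: tendsto_eq_intros)
    have bound: "eventually (\<lambda>p. measure \<rho> (boundary K (A (fst p) \<times> B (snd p))) / measure \<rho> (A (fst p) \<times> B (snd p))
        \<le> a (fst p) * (1 + b (snd p)) + (1 + a (fst p)) * b (snd p)) (net_filter (I \<times> J) (product_order r s))"
      unfolding eventually_net_filter[OF dir]
    proof (intro bexI[of _ "(i0, j0)"] ballI impI)
      fix p assume p: "p \<in> I \<times> J"
      then have "compact (A (fst p))" "compact (B (snd p))"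
        using cA cB by auto
      then show "measure \<rho> (boundary K (A (fst p) \<times> B (snd p))) / measure \<rho> (A (fst p) \<times> B (snd p))
          \<le> a (fst p) * (1 + b (snd p)) + (1 + a (fst p)) * b (snd p)"
        unfolding a_def b_def by (intro boundary_Times_ratio[OF \<mu> \<nu> \<rho> c K])
    qed (use ij in auto)
    show ?thesis
      by (rule tendsto_sandwich[OF _ bound tendsto_const lim]) simp
  qed
  moreover have "\<exists>p\<in>I \<times> J. \<forall>q\<in>I \<times> J. (p, q) \<in> product_order r s \<longrightarrow> interior (A (fst q) \<times> B (snd q)) \<noteq> {}"
    using ij by (intro bexI[of _ "(i0, j0)"]) (auto simp: product_order_def interior_Times)
  ultimately show ?thesis
    using dir cA cB by (auto simp: van_hove_net_def intro!: compact_Times)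
qed

section \<open>Upper integrals\<close>

text \<open>On functions that need not be measurable, the integral of the library is a supremum over simple
functions from below and is superadditive. The infimum over measurable majorants is subadditive.\<close>

definition upper_integral :: "'a measure \<Rightarrow> ('a \<Rightarrow> ennreal) \<Rightarrow> ennreal" where
  "upper_integral M f = (INF g\<in>{g\<in>borel_measurable M. f \<le> g}. \<integral>\<^sup>+x. g x \<partial>M)"

lemma upper_integral_le:
  assumes "g \<in> borel_measurable M" "f \<le> g"
  shows "upper_integral M f \<le> (\<integral>\<^sup>+x. g x \<partial>M)"
  using assms unfolding upper_integral_def by (intro INF_lower) auto

lemma upper_integral_mono:
  assumes "f \<le> g"
  shows "upper_integral M f \<le> upper_integral M g"
  unfolding upper_integral_def using assms by (intro INF_superset_mono) auto

lemma upper_integral_measurable: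
  assumes "f \<in> borel_measurable M"
  shows "upper_integral M f = (\<integral>\<^sup>+x. f x \<partial>M)"
proof (rule antisym)
  show "upper_integral M f \<le> (\<integral>\<^sup>+x. f x \<partial>M)"
    using assms by (intro upper_integral_le) auto
  show "(\<integral>\<^sup>+x. f x \<partial>M) \<le> upper_integral M f"
    unfolding upper_integral_def by (intro INF_greatest nn_integral_mono) (auto simp: le_fun_def)
qed

lemma upper_integral_add_le:
  "upper_integral M (\<lambda>x. f x + g x) \<le> upper_integral M f + upper_integral M g"
proof (rule ennreal_le_epsilon)
  fix e :: real assume fin: "upper_integral M f + upper_integral M g < top" and e: "0 < e"
  have approx: "\<exists>h\<in>borel_measurable M. k \<le> h \<and> (\<integral>\<^sup>+x. h x \<partial>M) \<le> upper_integral M k + ennreal (e / 2)"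
    if "upper_integral M k < top" for k
  proof -
    have "upper_integral M k < upper_integral M k + ennreal (e / 2)"
      using that e by (simp add: ennreal_add_left_cancel_less[of _ 0, simplified])
    then show ?thesis
      unfolding upper_integral_def by (subst (asm) (1) INF_less_iff) (auto intro: less_imp_le)
  qed
  obtain u where u: "u \<in> borel_measurable M" "f \<le> u" "(\<integral>\<^sup>+x. u x \<partial>M) \<le> upper_integral M f + ennreal (e / 2)"
    using approx[of f] fin by auto
  obtain v where v: "v \<in> borel_measurable M" "g \<le> v" "(\<integral>\<^sup>+x. v x \<partial>M) \<le> upper_integral M g + ennreal (e / 2)"
    using approx[of g] fin by auto
  have "upper_integral M (\<lambda>x. f x + g x) \<le> (\<integral>\<^sup>+x. u x + v x \<partial>M)"
    using u v by (intro upper_integral_le borel_measurable_add) (auto simp: le_fun_def intro: add_mono)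
  also have "\<dots> = (\<integral>\<^sup>+x. u x \<partial>M) + (\<integral>\<^sup>+x. v x \<partial>M)"
    using u v by (intro nn_integral_add)
  also have "\<dots> \<le> (upper_integral M f + ennreal (e / 2)) + (upper_integral M g + ennreal (e / 2))"
    using u v by (intro add_mono)
  also have "\<dots> = upper_integral M f + upper_integral M g + (ennreal (e / 2) + ennreal (e / 2))"
    by (simp add: ac_simps)
  also have "ennreal (e / 2) + ennreal (e / 2) = ennreal e"
    using e by (simp add: ennreal_plus[symmetric] del: ennreal_plus)
  finally show "upper_integral M (\<lambda>x. f x + g x) \<le> upper_integral M f + upper_integral M g + ennreal e" .
qed

lemma right_radon_distr_translate:
  assumes "right_radon \<mu>"
  shows "distr \<mu> borel (\<lambda>x. x - k) = \<mu>"
proof (rule measure_eqI)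
  have s: "sets \<mu> = sets borel"
    using assms by (simp add: right_radon_def)
  have sp: "space \<mu> = UNIV"
    using sets_eq_imp_space_eq[OF s] by simp
  have m: "(\<lambda>x. x - k) \<in> measurable \<mu> borel"
    using s by (simp add: borel_measurable_continuous_onI continuous_intros cong: measurable_cong_sets)
  show "sets (distr \<mu> borel (\<lambda>x. x - k)) = sets \<mu>"
    by (simp add: s)
  fix A assume "A \<in> sets (distr \<mu> borel (\<lambda>x. x - k))"
  then have A: "A \<in> sets borel"
    by simp
  have "emeasure (distr \<mu> borel (\<lambda>x. x - k)) A = emeasure \<mu> ((\<lambda>x. x + k) ` A)"
    using m A by (simp add: emeasure_distr sp translate_eq_vimage)
  then show "emeasure (distr \<mu> borel (\<lambda>x. x - k)) A = emeasure \<mu> A"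
    using assms A by (simp add: right_radon_def)
qed

text \<open>Translates of measurable majorants of \<open>f\<close> are measurable majorants of the translate of \<open>f\<close>, with the
same integral.\<close>

lemma upper_integral_translate_le:
  assumes "right_radon \<mu>"
  shows "upper_integral \<mu> (\<lambda>x. f (x - k)) \<le> upper_integral \<mu> f"
  unfolding upper_integral_def[of \<mu> f]
proof (rule INF_greatest, clarify)
  fix g assume g: "g \<in> borel_measurable \<mu>" "f \<le> g"
  have s: "sets \<mu> = sets borel"
    using assms by (simp add: right_radon_def)
  have m: "(\<lambda>x. x - k) \<in> measurable \<mu> borel"
    using s by (simp add: borel_measurable_continuous_onI continuous_intros cong: measurable_cong_sets)
  have gb: "g \<in> borel_measurable borel"
    using g(1) s by (simp cong: measurable_cong_sets)
  have "upper_integral \<mu> (\<lambda>x. f (x - k)) \<le> (\<integral>\<^sup>+x. g (x - k) \<partial>\<mu>)"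
    using g(2) measurable_compose[OF m gb] by (intro upper_integral_le) (auto simp: le_fun_def)
  also have "\<dots> = (\<integral>\<^sup>+x. g x \<partial>distr \<mu> borel (\<lambda>x. x - k))"
    using m gb by (subst nn_integral_distr) auto
  finally show "upper_integral \<mu> (\<lambda>x. f (x - k)) \<le> (\<integral>\<^sup>+x. g x \<partial>\<mu>)"
    by (simp add: right_radon_distr_translate[OF assms])
qed

lemma upper_integral_translate:
  assumes "right_radon \<mu>"
  shows "upper_integral \<mu> (\<lambda>x. f (x - k)) = upper_integral \<mu> f"
proof (rule antisym[OF upper_integral_translate_le[OF assms]])
  show "upper_integral \<mu> f \<le> upper_integral \<mu> (\<lambda>x. f (x - k))"
    using upper_integral_translate_le[OF assms, of "\<lambda>x. f (x - k)" "- k"]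
    by simp
qed

section \<open>Integrating set functions over slices\<close>

definition slice :: "('g \<times> 'h) set \<Rightarrow> 'h \<Rightarrow> 'g set" where
  "slice C h = {g. (g, h) \<in> C}"

definition slice_integral ::
  "'h::topological_group measure \<Rightarrow> ('g::topological_group set \<Rightarrow> real) \<Rightarrow> ('g \<times> 'h) set \<Rightarrow> real" where
  "slice_integral \<nu> f C = enn2real (upper_integral \<nu> (\<lambda>h. ennreal (f (slice C h))))"

lemma compact_slice:
  fixes C :: "('g::topological_group \<times> 'h::topological_group) set"
  assumes "compact C"
  shows "compact (slice C h)"
proof -
  have "slice C h = fst ` (C \<inter> UNIV \<times> {h})"
    by (force simp: slice_def)
  moreover have "compact (fst ` (C \<inter> UNIV \<times> {h}))"
    using assms by (intro compact_continuous_image compact_Int_closed closed_Times continuous_intros) auto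
  ultimately show ?thesis
    by simp
qed

text \<open>The value at the empty set is normalised to \<open>0\<close> so that slices outside the compact projection of a
set contribute nothing to the integral. Monotonicity then makes all values on compact sets
non-negative.\<close>

locale compact_set_function =
  fixes f :: "'g::topological_group set \<Rightarrow> real"
  assumes subadditive: "subadditive_on_compacts f"
    and invariant: "right_invariant_on_compacts f"
    and monotone: "monotone_on_compacts f"
    and empty: "f {} = 0"
begin

lemma mono: "compact A \<Longrightarrow> compact B \<Longrightarrow> A \<subseteq> B \<Longrightarrow> f A \<le> f B"
  using monotone by (simp add: monotone_on_compacts_def)

lemma nonneg: "compact A \<Longrightarrow> 0 \<le> f A"
  using mono[of "{}" A] empty by simp

text \<open>All slices lie in the first projection of \<open>C\<close>, and they are empty outside the second one.\<close>

lemma upper_integral_slice_finite: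
  fixes \<nu> :: "'h::topological_group measure"
  assumes \<nu>: "right_radon \<nu>" and C: "compact C"
  shows "upper_integral \<nu> (\<lambda>h. ennreal (f (slice C h))) < top"
proof -
  have c: "compact (fst ` C)" "compact (snd ` C)"
    using C by (auto intro!: compact_continuous_image continuous_intros)
  then have b: "snd ` C \<in> sets \<nu>"
    using \<nu> by (auto simp: right_radon_def borel_compact)
  have "ennreal (f (slice C h)) \<le> ennreal (f (fst ` C)) * indicator (snd ` C) h" for h
  proof (cases "h \<in> snd ` C")
    case True
    have "slice C h \<subseteq> fst ` C"
      by (force simp: slice_def)
    then show ?thesis
      using True c mono compact_slice[OF C] by (simp add: ennreal_leI)
  next
    case False
    then have "slice C h = {}"
      by (force simp: slice_def)
    then show ?thesis
      by (simp add: empty)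
  qed
  then have "upper_integral \<nu> (\<lambda>h. ennreal (f (slice C h)))
      \<le> (\<integral>\<^sup>+h. ennreal (f (fst ` C)) * indicator (snd ` C) h \<partial>\<nu>)"
    using b by (intro upper_integral_le) (auto simp: le_fun_def)
  also have "\<dots> = ennreal (f (fst ` C)) * emeasure \<nu> (snd ` C)"
    using b by (rule nn_integral_cmult_indicator)
  also have "\<dots> < top"
    using \<nu> c(2) by (simp add: right_radon_def ennreal_mult_less_top)
  finally show ?thesis .
qed

lemma slice_integral_rectangle:
  fixes \<nu> :: "'h::topological_group measure"
  assumes \<nu>: "right_radon \<nu>" and A: "compact A" and B: "compact B"
  shows "slice_integral \<nu> f (A \<times> B) = f A * measure \<nu> B"
proof -
  have b: "B \<in> sets \<nu>"
    using \<nu> B by (auto simp: right_radon_def borel_compact)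
  have "(\<lambda>h. ennreal (f (slice (A \<times> B) h))) = (\<lambda>h. ennreal (f A) * indicator B h)"
    by (auto simp: slice_def empty indicator_def fun_eq_iff)
  then have "upper_integral \<nu> (\<lambda>h. ennreal (f (slice (A \<times> B) h))) = ennreal (f A) * emeasure \<nu> B"
    using b by (simp add: upper_integral_measurable nn_integral_cmult_indicator)
  then show ?thesis
    using nonneg[OF A] by (simp add: slice_integral_def enn2real_mult measure_def)
qed

lemma slice_integral_subadditive:
  fixes \<nu> :: "'h::topological_group measure"
  assumes \<nu>: "right_radon \<nu>"
  shows "subadditive_on_compacts (slice_integral \<nu> f)"
  unfolding subadditive_on_compacts_def
proof (intro allI impI)
  fix C D :: "('g \<times> 'h) set"
  assume "compact C \<and> compact D \<and> C \<inter> D = {}"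
  then have C: "compact C" and D: "compact D" and "C \<inter> D = {}"
    by auto
  have "ennreal (f (slice (C \<union> D) h)) \<le> ennreal (f (slice C h)) + ennreal (f (slice D h))" for h
  proof -
    have "slice (C \<union> D) h = slice C h \<union> slice D h" "slice C h \<inter> slice D h = {}"
      using \<open>C \<inter> D = {}\<close> by (auto simp: slice_def)
    then have "f (slice (C \<union> D) h) \<le> f (slice C h) + f (slice D h)"
      using subadditive compact_slice[OF C] compact_slice[OF D]
      by (simp add: subadditive_on_compacts_def)
    then show ?thesis
      using nonneg compact_slice[OF C] compact_slice[OF D]
      by (simp add: ennreal_plus[symmetric] ennreal_leI del: ennreal_plus)
  qed
  then have "upper_integral \<nu> (\<lambda>h. ennreal (f (slice (C \<union> D) h)))
      \<le> upper_integral \<nu> (\<lambda>h. ennreal (f (slice C h)) + ennreal (f (slice D h)))"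
    by (intro upper_integral_mono) (simp add: le_fun_def)
  also have "\<dots> \<le> upper_integral \<nu> (\<lambda>h. ennreal (f (slice C h))) + upper_integral \<nu> (\<lambda>h. ennreal (f (slice D h)))"
    by (rule upper_integral_add_le)
  finally show "slice_integral \<nu> f (C \<union> D) \<le> slice_integral \<nu> f C + slice_integral \<nu> f D"
    using upper_integral_slice_finite[OF \<nu> C] upper_integral_slice_finite[OF \<nu> D]
    unfolding slice_integral_def by (subst enn2real_plus[symmetric]) (auto intro!: enn2real_mono)
qed

lemma slice_integral_invariant:
  fixes \<nu> :: "'h::topological_group measure"
  assumes \<nu>: "right_radon \<nu>"
  shows "right_invariant_on_compacts (slice_integral \<nu> f)"
  unfolding right_invariant_on_compacts_def
proof (intro allI impI)
  fix C :: "('g \<times> 'h) set" and p :: "'g \<times> 'h"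
  assume C: "compact C"
  have "slice ((\<lambda>a. a + p) ` C) h = (\<lambda>a. a + fst p) ` slice C (h - snd p)" for h
    unfolding translate_eq_vimage by (cases p) (auto simp: slice_def)
  then have "f (slice ((\<lambda>a. a + p) ` C) h) = f (slice C (h - snd p))" for h
    using invariant compact_slice[OF C] by (simp add: right_invariant_on_compacts_def)
  then show "slice_integral \<nu> f ((\<lambda>a. a + p) ` C) = slice_integral \<nu> f C"
    using upper_integral_translate[OF \<nu>, of "\<lambda>h. ennreal (f (slice C h))"]
    by (simp add: slice_integral_def)
qed

lemma slice_integral_monotone:
  fixes \<nu> :: "'h::topological_group measure"
  assumes \<nu>: "right_radon \<nu>"
  shows "monotone_on_compacts (slice_integral \<nu> f)"
  unfolding monotone_on_compacts_def
proof (intro allI impI)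
  fix C D :: "('g \<times> 'h) set"
  assume "compact C \<and> compact D \<and> C \<subseteq> D"
  then have C: "compact C" and D: "compact D" and "C \<subseteq> D"
    by auto
  then have "slice C h \<subseteq> slice D h" for h
    by (auto simp: slice_def)
  then have "upper_integral \<nu> (\<lambda>h. ennreal (f (slice C h))) \<le> upper_integral \<nu> (\<lambda>h. ennreal (f (slice D h)))"
    using mono compact_slice[OF C] compact_slice[OF D]
    by (intro upper_integral_mono) (auto simp: le_fun_def intro!: ennreal_leI)
  then show "slice_integral \<nu> f C \<le> slice_integral \<nu> f D"
    using upper_integral_slice_finite[OF \<nu> D] unfolding slice_integral_def by (intro enn2real_mono)
qed

end

lemma swap_preserves_set_function_properties:
  fixes F :: "('h::topological_group \<times> 'g::topological_group) set \<Rightarrow> real"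
  assumes "subadditive_on_compacts F" "right_invariant_on_compacts F" "monotone_on_compacts F"
  shows "subadditive_on_compacts (\<lambda>C. F (prod.swap ` C))"
    and "right_invariant_on_compacts (\<lambda>C. F (prod.swap ` C))"
    and "monotone_on_compacts (\<lambda>C. F (prod.swap ` C))"
proof -
  have inj: "prod.swap ` C \<inter> prod.swap ` D = {}" if "C \<inter> D = {}" for C D :: "('g \<times> 'h) set"
    using that by auto
  show "subadditive_on_compacts (\<lambda>C. F (prod.swap ` C))"
    using assms(1) compact_swap inj unfolding subadditive_on_compacts_def image_Un by metis
  show "monotone_on_compacts (\<lambda>C. F (prod.swap ` C))"
    using assms(3) compact_swap image_mono unfolding monotone_on_compacts_def by metis
  show "right_invariant_on_compacts (\<lambda>C. F (prod.swap ` C))"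
    unfolding right_invariant_on_compacts_def
  proof (intro allI impI)
    fix C :: "('g \<times> 'h) set" and p assume C: "compact C"
    have "prod.swap ` ((\<lambda>a. a + p) ` C) = (\<lambda>a. a + prod.swap p) ` (prod.swap ` C)"
      by (simp add: image_image swap_plus)
    then show "F (prod.swap ` ((\<lambda>a. a + p) ` C)) = F (prod.swap ` C)"
      using assms(2)[unfolded right_invariant_on_compacts_def, rule_format, OF compact_swap[OF C]]
      by metis
  qed
qed

lemma subadditive_empty_nonneg:
  assumes "subadditive_on_compacts f"
  shows "0 \<le> f {}"
  using assms[unfolded subadditive_on_compacts_def, rule_format, of "{}" "{}"] by simp

text \<open>Resetting the value at the empty set does not break monotonicity, since subadditivity forces
\<open>f {} \<ge> 0\<close> and hence \<open>f \<ge> 0\<close>. The sets of a Van Hove net are eventually non-empty, so limits along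
the net do not change either.\<close>

lemma compact_set_function_normalize:
  assumes sub: "subadditive_on_compacts f" and inv: "right_invariant_on_compacts f"
    and mono: "monotone_on_compacts f"
  shows "compact_set_function (f({} := 0))"
proof
  have nn: "0 \<le> f A" if "compact A" for A
    using subadditive_empty_nonneg[OF sub] mono that unfolding monotone_on_compacts_def
    by (meson compact_empty empty_subsetI order_trans)
  show "subadditive_on_compacts (f({} := 0))"
    using sub unfolding subadditive_on_compacts_def by auto
  show "right_invariant_on_compacts (f({} := 0))"
    using inv unfolding right_invariant_on_compacts_def by auto
  show "monotone_on_compacts (f({} := 0))"
    using mono nn unfolding monotone_on_compacts_def by auto
qed simp

section \<open>Passing the Ornstein--Weiss lemma to the factors\<close>

lemma van_hove_net_eventually_pos:
  assumes "haar_measure \<mu>" "van_hove_net \<mu> I r A"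
  shows "eventually (\<lambda>i. 0 < measure \<mu> (A i) \<and> compact (A i) \<and> A i \<noteq> {}) (net_filter I r)"
proof -
  have I: "directed_set I r"
    using assms(2) by (simp add: van_hove_net_def)
  have "\<exists>j\<in>I. \<forall>i\<in>I. (j, i) \<in> r \<longrightarrow> interior (A i) \<noteq> {}"
    and c: "\<forall>i\<in>I. compact (A i)"
    using assms(2) by (simp_all add: van_hove_net_def)
  then obtain j where j: "j \<in> I" "\<forall>i\<in>I. (j, i) \<in> r \<longrightarrow> interior (A i) \<noteq> {}"
    by blast
  show ?thesis
    unfolding eventually_net_filter[OF I]
  proof (intro bexI[of _ j] ballI impI)
    fix i assume "i \<in> I" "(j, i) \<in> r"
    then have "compact (A i)" "interior (A i) \<noteq> {}"
      using j c by auto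
    then show "0 < measure \<mu> (A i) \<and> compact (A i) \<and> A i \<noteq> {}"
      using haar_measure_pos[OF assms(1)] by auto
  qed (rule j)
qed

text \<open>The Ornstein--Weiss lemma of the product, applied to products of Van Hove nets. The constant \<open>c\<close> that
relates \<open>\<rho>\<close> to \<open>\<mu>\<close> and \<open>\<nu>\<close> is absorbed into the limit.\<close>

lemma ornstein_weiss_rectangles:
  fixes \<mu> :: "'g::topological_group measure"
    and \<nu> :: "'h::topological_group measure"
    and \<rho> :: "('g \<times> 'h) measure"
  assumes \<mu>: "unimodular_group \<mu>" and \<nu>: "unimodular_group \<nu>"
    and \<rho>: "haar_measure \<rho>" "ornstein_weiss \<rho>"
    and F: "subadditive_on_compacts F" "right_invariant_on_compacts F" "monotone_on_compacts F"
  obtains L where "\<And>(I :: 'g net_index set) r A (J :: 'h net_index set) s B.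
      van_hove_net \<mu> I r A \<Longrightarrow> van_hove_net \<nu> J s B \<Longrightarrow>
      ((\<lambda>p. F (A (fst p) \<times> B (snd p)) / (measure \<mu> (A (fst p)) * measure \<nu> (B (snd p)))) \<longlongrightarrow> L)
        (net_filter I r \<times>\<^sub>F net_filter J s)"
proof -
  have h\<mu>: "haar_measure \<mu>" and lcG: "locally_compact_space (euclidean :: 'g topology)"
    and h\<nu>: "haar_measure \<nu>" and lcH: "locally_compact_space (euclidean :: 'h topology)"
    using \<mu> \<nu> by (auto simp: unimodular_group_def)
  note rad = haar_measure_right_radon[OF h\<mu>] haar_measure_right_radon[OF h\<nu>]
    haar_measure_right_radon[OF \<rho>(1)]
  obtain c where c: "0 < c"
    "\<And>A B. compact A \<Longrightarrow> compact B \<Longrightarrow> measure \<rho> (A \<times> B) = c * (measure \<mu> A * measure \<nu> B)"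
    using haar_measure_rectangle[OF lcG h\<mu> lcH h\<nu> \<rho>(1)] by metis
  obtain L where L: "\<And>(K :: ('g \<times> 'h) net_index set) t D. van_hove_net \<rho> K t D \<Longrightarrow>
      ((\<lambda>k. F (D k) / measure \<rho> (D k)) \<longlongrightarrow> L) (net_filter K t)"
    using \<rho>(2) F unfolding ornstein_weiss_def by blast
  show ?thesis
  proof (rule that[of "c * L"])
    fix I :: "'g net_index set" and r A and J :: "'h net_index set" and s B
    assume A: "van_hove_net \<mu> I r A" and B: "van_hove_net \<nu> J s B"
    then have I: "directed_set I r" and J: "directed_set J s"
      by (auto simp: van_hove_net_def)
    let ?N = "net_filter I r \<times>\<^sub>F net_filter J s"
    have "((\<lambda>p. F (A (fst p) \<times> B (snd p)) / measure \<rho> (A (fst p) \<times> B (snd p))) \<longlongrightarrow> L) ?N"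
      using ornstein_weiss_any_index[OF L van_hove_net_product[OF rad c A B]]
      by (simp add: net_filter_product[OF I J])
    then have "((\<lambda>p. c * (F (A (fst p) \<times> B (snd p)) / measure \<rho> (A (fst p) \<times> B (snd p)))) \<longlongrightarrow> c * L) ?N"
      by (rule tendsto_mult_left)
    moreover have "eventually (\<lambda>p. c * (F (A (fst p) \<times> B (snd p)) / measure \<rho> (A (fst p) \<times> B (snd p)))
        = F (A (fst p) \<times> B (snd p)) / (measure \<mu> (A (fst p)) * measure \<nu> (B (snd p)))) ?N"
      using van_hove_net_eventually_pos[OF h\<mu> A] van_hove_net_eventually_pos[OF h\<nu> B]
      by (rule eventually_prod_filterI) (use c in simp)
    ultimately show "((\<lambda>p. F (A (fst p) \<times> B (snd p)) / (measure \<mu> (A (fst p)) * measure \<nu> (B (snd p))))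
        \<longlongrightarrow> c * L) ?N"
      by (rule Lim_transform_eventually)
  qed
qed

theorem theorem1p2:
  fixes \<mu> :: "'g::topological_group measure"
    and \<nu> :: "'h::topological_group measure"
    and \<rho> :: "('g \<times> 'h) measure"
  assumes "amenable_group \<mu>" and "amenable_group \<nu>"
    and "haar_measure \<rho>" and "ornstein_weiss \<rho>"
  shows "ornstein_weiss \<mu> \<and> ornstein_weiss \<nu>"
proof -
  have uni: "unimodular_group \<mu>" "unimodular_group \<nu>"
    using assms(1,2) by (auto simp: amenable_group_def)
  then have \<mu>: "haar_measure \<mu>" and \<nu>: "haar_measure \<nu>"
    by (auto simp: unimodular_group_def)
  note rad = haar_measure_right_radon[OF \<mu>] haar_measure_right_radon[OF \<nu>]
  note rectangles = ornstein_weiss_rectangles[OF uni assms(3,4)]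
  obtain I\<^sub>G :: "'g net_index set" and r\<^sub>G A\<^sub>G where netG: "van_hove_net \<mu> I\<^sub>G r\<^sub>G A\<^sub>G"
    using assms(1) unfolding amenable_group_def by blast
  obtain I\<^sub>H :: "'h net_index set" and r\<^sub>H A\<^sub>H where netH: "van_hove_net \<nu> I\<^sub>H r\<^sub>H A\<^sub>H"
    using assms(2) unfolding amenable_group_def by blast
  have dirG: "directed_set I\<^sub>G r\<^sub>G" and dirH: "directed_set I\<^sub>H r\<^sub>H"
    using netG netH by (simp_all add: van_hove_net_def)
  have "ornstein_weiss \<mu>"
    unfolding ornstein_weiss_def
  proof (intro allI impI)
    fix f :: "'g set \<Rightarrow> real"
    assume f: "subadditive_on_compacts f \<and> right_invariant_on_compacts f \<and> monotone_on_compacts f"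
    interpret compact_set_function "f({} := 0)"
      using f by (intro compact_set_function_normalize) auto
    let ?F = "slice_integral \<nu> (f({} := 0))"
    obtain L where L: "\<And>(I :: 'g net_index set) r A (J :: 'h net_index set) s B.
      van_hove_net \<mu> I r A \<Longrightarrow> van_hove_net \<nu> J s B \<Longrightarrow>
      ((\<lambda>p. ?F (A (fst p) \<times> B (snd p)) / (measure \<mu> (A (fst p)) * measure \<nu> (B (snd p)))) \<longlongrightarrow> L)
        (net_filter I r \<times>\<^sub>F net_filter J s)"
      by (rule rectangles[OF slice_integral_subadditive[OF rad(2)] slice_integral_invariant[OF rad(2)]
          slice_integral_monotone[OF rad(2)]], rule that, blast)
    show "\<exists>L. \<forall>(I :: 'g net_index set) r A. van_hove_net \<mu> I r A \<longrightarrow>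
        ((\<lambda>i. f (A i) / measure \<mu> (A i)) \<longlongrightarrow> L) (net_filter I r)"
    proof (rule exI[of _ L], intro allI impI)
      fix I :: "'g net_index set" and r A assume A: "van_hove_net \<mu> I r A"
      let ?N = "net_filter I r \<times>\<^sub>F net_filter I\<^sub>H r\<^sub>H"
      have "eventually (\<lambda>p. ?F (A (fst p) \<times> A\<^sub>H (snd p)) / (measure \<mu> (A (fst p)) * measure \<nu> (A\<^sub>H (snd p)))
          = f (A (fst p)) / measure \<mu> (A (fst p))) ?N"
        using van_hove_net_eventually_pos[OF \<mu> A] van_hove_net_eventually_pos[OF \<nu> netH]
        by (rule eventually_prod_filterI) (simp add: slice_integral_rectangle[OF rad(2)])
      then have "((\<lambda>p. f (A (fst p)) / measure \<mu> (A (fst p))) \<longlongrightarrow> L) ?N"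
        using L[OF A netH] by (rule Lim_transform_eventually[rotated])
      then show "((\<lambda>i. f (A i) / measure \<mu> (A i)) \<longlongrightarrow> L) (net_filter I r)"
        by (rule tendsto_prod_filter_fstD) (rule net_filter_not_bot[OF dirH])
    qed
  qed
  moreover have "ornstein_weiss \<nu>"
    unfolding ornstein_weiss_def
  proof (intro allI impI)
    fix f :: "'h set \<Rightarrow> real"
    assume f: "subadditive_on_compacts f \<and> right_invariant_on_compacts f \<and> monotone_on_compacts f"
    interpret compact_set_function "f({} := 0)"
      using f by (intro compact_set_function_normalize) auto
    let ?F = "\<lambda>C. slice_integral \<mu> (f({} := 0)) (prod.swap ` C)"
    have rect: "?F (A \<times> B) = (f({} := 0)) B * measure \<mu> A" if "compact A" "compact B" for A B
    proof -
      have "prod.swap ` (A \<times> B) = B \<times> A"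
        by force
      then show ?thesis
        by (simp only: slice_integral_rectangle[OF rad(1) that(2,1)])
    qed
    obtain L where L: "\<And>(I :: 'g net_index set) r A (J :: 'h net_index set) s B.
      van_hove_net \<mu> I r A \<Longrightarrow> van_hove_net \<nu> J s B \<Longrightarrow>
      ((\<lambda>p. ?F (A (fst p) \<times> B (snd p)) / (measure \<mu> (A (fst p)) * measure \<nu> (B (snd p)))) \<longlongrightarrow> L)
        (net_filter I r \<times>\<^sub>F net_filter J s)"
      by (rule rectangles[OF swap_preserves_set_function_properties[OF slice_integral_subadditive[OF rad(1)]
          slice_integral_invariant[OF rad(1)] slice_integral_monotone[OF rad(1)]]], rule that, blast)
    show "\<exists>L. \<forall>(J :: 'h net_index set) s B. van_hove_net \<nu> J s B \<longrightarrow>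
        ((\<lambda>j. f (B j) / measure \<nu> (B j)) \<longlongrightarrow> L) (net_filter J s)"
    proof (rule exI[of _ L], intro allI impI)
      fix J :: "'h net_index set" and s B assume B: "van_hove_net \<nu> J s B"
      let ?N = "net_filter I\<^sub>G r\<^sub>G \<times>\<^sub>F net_filter J s"
      have "eventually (\<lambda>p. ?F (A\<^sub>G (fst p) \<times> B (snd p)) / (measure \<mu> (A\<^sub>G (fst p)) * measure \<nu> (B (snd p)))
          = f (B (snd p)) / measure \<nu> (B (snd p))) ?N"
        using van_hove_net_eventually_pos[OF \<mu> netG] van_hove_net_eventually_pos[OF \<nu> B]
        by (rule eventually_prod_filterI) (simp only: fst_conv snd_conv rect, simp)
      then have "((\<lambda>p. f (B (snd p)) / measure \<nu> (B (snd p))) \<longlongrightarrow> L) ?N"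
        using L[OF netG B] by (rule Lim_transform_eventually[rotated])
      then show "((\<lambda>j. f (B j) / measure \<nu> (B j)) \<longlongrightarrow> L) (net_filter J s)"
        by (rule tendsto_prod_filter_sndD) (rule net_filter_not_bot[OF dirG])
    qed
  qed
  ultimately show ?thesis ..
qed

end
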